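(* Let $p$ be prime, $m\ge1$, $n=2m+1$, and $G=\mathbb U_{m+1}(\mathbb F_p)\times\mathbb U_{m+1}(\mathbb F_p)$. The cohomology class in $H^2(G,S_n)$ of the extension $0\to S_n\to\mathbb U_n(\mathbb F_p)\to G\to1$ equals the cup product $\phi_1\smile\phi_2$, computed with respect to the $G$-equivariant pairing $V_m\otimes V_m^*\to S_n$, $v\otimes r\mapsto vr$.
   Context: $\mathbb U_k(\mathbb F_p)$: upper unitriangular $k\times k$ matrices over $\mathbb F_p$. $S_n\subset\mathbb U_n$ is the abelian normal subgroup of matrices $I+h$ with $h$ supported in rows $1,\dots,m$, columns $m+2,\dots,2m+1$; it is identified with the additive group of $m\times m$ matrices $X$ (that block). The map $\mathbb U_n\to G$ sends $g$ to (its top-left $(m+1)\times(m+1)$ block, its bottom-right $(m+1)\times(m+1)$ block); its kernel is $S_n$, and $G$ acts on $S_n$ by conjugation, namely $(g_1,g_2)\cdot X=\pi(g_1)X\pi'(g_2)^{-1}$, where $\pi,\pi'\colon\mathbb U_{m+1}\to\mathbb U_m$ delete respectively the last row and column, and the first row and column. $V_m$ = column vectors in $\mathbb F_p^m$ with $(g_1,g_2)\cdot v=\pi(g_1)v$; $V_m^*$ = row vectors with $(g_1,g_2)\cdot r=r\,\pi'(g_2)^{-1}$. For $g\in\mathbb U_{m+1}$ let $\phi(g)\in V_m$ be the last column of $g$ with its last entry deleted, and $\psi(g)\in V_m^*$ the first row of $g$ with its first entry deleted. The 1-cocycles are $\phi_1(g_1,g_2)=\phi(g_1)\in V_m$ and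 $\phi_2(g_1,g_2)=\psi(g_2)\pi'(g_2)^{-1}\in V_m^*$. The cup product is represented by the 2-cocycle $(g,g')\mapsto\phi_1(g)\,(g\cdot\phi_2(g'))$; the class of an extension is that of the 2-cocycle arising from a set-theoretic section. *)

theory Defs
  imports
    "HOL-Algebra.Coset"
    "Jordan_Normal_Form.Determinant"
    "Berlekamp_Zassenhaus.Finite_Field"
begin

section \<open>Group cohomology in low degrees\<close>

text \<open>Coefficient modules are abelian groups in the sense of HOL-Algebra, hence written
  multiplicatively here, even though the modules of interest are additive groups of matrices.\<close>

locale group_module = G: group G + A: comm_group A
  for G :: "('g, 'x) monoid_scheme" (structure)
    and A :: "('a, 'y) monoid_scheme" (structure)
    and act :: "'g \<Rightarrow> 'a \<Rightarrow> 'a" +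
  assumes act_closed: "\<lbrakk>g \<in> carrier G; a \<in> carrier A\<rbrakk> \<Longrightarrow> act g a \<in> carrier A"
    and act_add: "\<lbrakk>g \<in> carrier G; a \<in> carrier A; b \<in> carrier A\<rbrakk>
          \<Longrightarrow> act g (a \<otimes>\<^bsub>A\<^esub> b) = act g a \<otimes>\<^bsub>A\<^esub> act g b"
    and act_one: "a \<in> carrier A \<Longrightarrow> act \<one>\<^bsub>G\<^esub> a = a"
    and act_mult: "\<lbrakk>g \<in> carrier G; h \<in> carrier G; a \<in> carrier A\<rbrakk>
          \<Longrightarrow> act (g \<otimes>\<^bsub>G\<^esub> h) a = act g (act h a)"

definition one_cocycles ::
  "('g, 'x) monoid_scheme \<Rightarrow> ('a, 'y) monoid_scheme \<Rightarrow> ('g \<Rightarrow> 'a \<Rightarrow> 'a) \<Rightarrow> ('g \<Rightarrow> 'a) set" where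
  "one_cocycles G A act = {f \<in> carrier G \<rightarrow> carrier A.
     \<forall>g\<in>carrier G. \<forall>h\<in>carrier G. f (g \<otimes>\<^bsub>G\<^esub> h) = f g \<otimes>\<^bsub>A\<^esub> act g (f h)}"

definition two_cocycles ::
  "('g, 'x) monoid_scheme \<Rightarrow> ('a, 'y) monoid_scheme \<Rightarrow> ('g \<Rightarrow> 'a \<Rightarrow> 'a) \<Rightarrow> ('g \<times> 'g \<Rightarrow> 'a) monoid" where
  "two_cocycles G A act =
     \<lparr>carrier = {f \<in> carrier G \<times> carrier G \<rightarrow>\<^sub>E carrier A.
        \<forall>g\<in>carrier G. \<forall>h\<in>carrier G. \<forall>k\<in>carrier G.
          act g (f (h, k)) \<otimes>\<^bsub>A\<^esub> f (g, h \<otimes>\<^bsub>G\<^esub> k) = f (g \<otimes>\<^bsub>G\<^esub> h, k) \<otimes>\<^bsub>A\<^esub> f (g, h)},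
      mult = (\<lambda>f f'. \<lambda>x\<in>carrier G \<times> carrier G. f x \<otimes>\<^bsub>A\<^esub> f' x),
      one = (\<lambda>x\<in>carrier G \<times> carrier G. \<one>\<^bsub>A\<^esub>)\<rparr>"

definition two_coboundaries ::
  "('g, 'x) monoid_scheme \<Rightarrow> ('a, 'y) monoid_scheme \<Rightarrow> ('g \<Rightarrow> 'a \<Rightarrow> 'a) \<Rightarrow> ('g \<times> 'g \<Rightarrow> 'a) set" where
  "two_coboundaries G A act =
     {(\<lambda>(g, h)\<in>carrier G \<times> carrier G.
         act g (c h) \<otimes>\<^bsub>A\<^esub> inv\<^bsub>A\<^esub> c (g \<otimes>\<^bsub>G\<^esub> h) \<otimes>\<^bsub>A\<^esub> c g) | c. c \<in> carrier G \<rightarrow> carrier A}"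

definition H2 ::
  "('g, 'x) monoid_scheme \<Rightarrow> ('a, 'y) monoid_scheme \<Rightarrow> ('g \<Rightarrow> 'a \<Rightarrow> 'a) \<Rightarrow> ('g \<times> 'g \<Rightarrow> 'a) set monoid" where
  "H2 G A act = two_cocycles G A act Mod two_coboundaries G A act"

definition H2_class ::
  "('g, 'x) monoid_scheme \<Rightarrow> ('a, 'y) monoid_scheme \<Rightarrow> ('g \<Rightarrow> 'a \<Rightarrow> 'a) \<Rightarrow>
   ('g \<times> 'g \<Rightarrow> 'a) \<Rightarrow> ('g \<times> 'g \<Rightarrow> 'a) set" where
  "H2_class G A act f = two_coboundaries G A act #>\<^bsub>two_cocycles G A act\<^esub> f"


subsection \<open>The class of an extension with abelian kernel\<close>

text \<open>An extension $0 \to A \to E \to G \to 1$ whose conjugation action on $A$ is the given one.\<close>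

locale abelian_extension = group_module G A act + E: group E
  for G :: "('g, 'x) monoid_scheme" (structure)
    and A :: "('a, 'y) monoid_scheme" (structure)
    and act :: "'g \<Rightarrow> 'a \<Rightarrow> 'a"
    and E :: "('e, 'z) monoid_scheme" (structure)
    and \<iota> :: "'a \<Rightarrow> 'e"
    and q :: "'e \<Rightarrow> 'g" +
  assumes \<iota>_hom: "\<iota> \<in> hom A E"
    and \<iota>_inj: "inj_on \<iota> (carrier A)"
    and q_hom: "q \<in> hom E G"
    and q_surj: "q ` carrier E = carrier G"
    and exact: "\<iota> ` carrier A = kernel E G q"
    and conj_act: "\<lbrakk>e \<in> carrier E; a \<in> carrier A\<rbrakk>
          \<Longrightarrow> e \<otimes>\<^bsub>E\<^esub> \<iota> a \<otimes>\<^bsub>E\<^esub> inv\<^bsub>E\<^esub> e = \<iota> (act (q e) a)"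

definition set_sections ::
  "('g, 'x) monoid_scheme \<Rightarrow> ('e, 'z) monoid_scheme \<Rightarrow> ('e \<Rightarrow> 'g) \<Rightarrow> ('g \<Rightarrow> 'e) set" where
  "set_sections G E q = {s \<in> carrier G \<rightarrow> carrier E. \<forall>g\<in>carrier G. q (s g) = g}"

text \<open>The convention is $s(g)\,s(h) = \iota(f(g,h))\,s(gh)$.\<close>

definition section_cocycle ::
  "('g, 'x) monoid_scheme \<Rightarrow> ('a, 'y) monoid_scheme \<Rightarrow> ('e, 'z) monoid_scheme \<Rightarrow>
   ('a \<Rightarrow> 'e) \<Rightarrow> ('g \<Rightarrow> 'e) \<Rightarrow> ('g \<times> 'g \<Rightarrow> 'a)" where
  "section_cocycle G A E \<iota> s = (\<lambda>(g, h)\<in>carrier G \<times> carrier G.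
     inv_into (carrier A) \<iota> (s g \<otimes>\<^bsub>E\<^esub> s h \<otimes>\<^bsub>E\<^esub> inv\<^bsub>E\<^esub> s (g \<otimes>\<^bsub>G\<^esub> h)))"

definition extension_class ::
  "('g, 'x) monoid_scheme \<Rightarrow> ('a, 'y) monoid_scheme \<Rightarrow> ('g \<Rightarrow> 'a \<Rightarrow> 'a) \<Rightarrow>
   ('e, 'z) monoid_scheme \<Rightarrow> ('a \<Rightarrow> 'e) \<Rightarrow> ('e \<Rightarrow> 'g) \<Rightarrow> ('g \<times> 'g \<Rightarrow> 'a) set" where
  "extension_class G A act E \<iota> q =
     (THE c. \<exists>s\<in>set_sections G E q. c = H2_class G A act (section_cocycle G A E \<iota> s))"


subsection \<open>Cup products of 1-cocycles\<close>

locale equivariant_pairing =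
  A: group_module G A actA + B: group_module G B actB + C: group_module G C actC
  for G :: "('g, 'x) monoid_scheme" (structure)
    and A :: "('a, 'y) monoid_scheme" (structure) and actA :: "'g \<Rightarrow> 'a \<Rightarrow> 'a"
    and B :: "('b, 'z) monoid_scheme" (structure) and actB :: "'g \<Rightarrow> 'b \<Rightarrow> 'b"
    and C :: "('c, 'w) monoid_scheme" (structure) and actC :: "'g \<Rightarrow> 'c \<Rightarrow> 'c"
    and pair :: "'a \<Rightarrow> 'b \<Rightarrow> 'c" +
  assumes pair_closed: "\<lbrakk>a \<in> carrier A; b \<in> carrier B\<rbrakk> \<Longrightarrow> pair a b \<in> carrier C"
    and pair_add_left: "\<lbrakk>a \<in> carrier A; a' \<in> carrier A; b \<in> carrier B\<rbrakk>
          \<Longrightarrow> pair (a \<otimes>\<^bsub>A\<^esub> a') b = pair a b \<otimes>\<^bsub>C\<^esub> pair a' b"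
    and pair_add_right: "\<lbrakk>a \<in> carrier A; b \<in> carrier B; b' \<in> carrier B\<rbrakk>
          \<Longrightarrow> pair a (b \<otimes>\<^bsub>B\<^esub> b') = pair a b \<otimes>\<^bsub>C\<^esub> pair a b'"
    and pair_equivariant: "\<lbrakk>g \<in> carrier G; a \<in> carrier A; b \<in> carrier B\<rbrakk>
          \<Longrightarrow> pair (actA g a) (actB g b) = actC g (pair a b)"

definition cup_cocycle ::
  "('g, 'x) monoid_scheme \<Rightarrow> ('g \<Rightarrow> 'b \<Rightarrow> 'b) \<Rightarrow> ('a \<Rightarrow> 'b \<Rightarrow> 'c) \<Rightarrow>
   ('g \<Rightarrow> 'a) \<Rightarrow> ('g \<Rightarrow> 'b) \<Rightarrow> ('g \<times> 'g \<Rightarrow> 'c)" where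
  "cup_cocycle G actB pair f f' =
     (\<lambda>(g, h)\<in>carrier G \<times> carrier G. pair (f g) (actB g (f' h)))"

definition cup_product ::
  "('g, 'x) monoid_scheme \<Rightarrow> ('g \<Rightarrow> 'b \<Rightarrow> 'b) \<Rightarrow> ('c, 'w) monoid_scheme \<Rightarrow> ('g \<Rightarrow> 'c \<Rightarrow> 'c) \<Rightarrow>
   ('a \<Rightarrow> 'b \<Rightarrow> 'c) \<Rightarrow> ('g \<Rightarrow> 'a) \<Rightarrow> ('g \<Rightarrow> 'b) \<Rightarrow> ('g \<times> 'g \<Rightarrow> 'c) set" where
  "cup_product G actB C actC pair f f' = H2_class G C actC (cup_cocycle G actB pair f f')"


section \<open>Unitriangular matrices\<close>

text \<open>Matrix indices start at 0, so row or column $i$ of the mathematics has index $i - 1$.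
  Column vectors are $m \times 1$ matrices and row vectors are $1 \times m$ matrices.\<close>

definition unitriangular :: "nat \<Rightarrow> 'a :: comm_ring_1 mat monoid" where
  "unitriangular k =
     \<lparr>carrier = {g \<in> carrier_mat k k. upper_triangular g \<and> (\<forall>i<k. g $$ (i, i) = 1)},
      mult = (*), one = 1\<^sub>m k\<rparr>"

definition top_left :: "nat \<Rightarrow> 'a mat \<Rightarrow> 'a mat" where
  "top_left m g = mat (m + 1) (m + 1) (\<lambda>(i, j). g $$ (i, j))"

definition bottom_right :: "nat \<Rightarrow> 'a mat \<Rightarrow> 'a mat" where
  "bottom_right m g = mat (m + 1) (m + 1) (\<lambda>(i, j). g $$ (i + m, j + m))"

definition block_proj :: "nat \<Rightarrow> 'a mat \<Rightarrow> 'a mat \<times> 'a mat" where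
  "block_proj m g = (top_left m g, bottom_right m g)"

text \<open>The identification of the additive group of $m \times m$ matrices with the subgroup $S_n$
  of $\mathbb U_n$, where $n = 2m+1$: the matrix $X$ is sent to $I + h$, where $h$ has $X$ in
  rows $1, \dots, m$ and columns $m+2, \dots, 2m+1$ and is zero elsewhere.\<close>

definition S_embed :: "nat \<Rightarrow> 'a :: comm_ring_1 mat \<Rightarrow> 'a mat" where
  "S_embed m X = 1\<^sub>m (2 * m + 1) +
     mat (2 * m + 1) (2 * m + 1) (\<lambda>(i, j). if i < m \<and> m < j then X $$ (i, j - (m + 1)) else 0)"

definition del_last :: "nat \<Rightarrow> 'a mat \<Rightarrow> 'a mat" where
  "del_last m g = mat_delete g m m"

definition del_first :: "'a mat \<Rightarrow> 'a mat" where
  "del_first g = mat_delete g 0 0"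

definition S_act :: "nat \<Rightarrow> 'a :: comm_ring_1 mat \<times> 'a mat \<Rightarrow> 'a mat \<Rightarrow> 'a mat" where
  "S_act m = (\<lambda>(g1, g2) X. del_last m g1 * X * inv\<^bsub>unitriangular m\<^esub> (del_first g2))"

definition V_act :: "nat \<Rightarrow> 'a :: comm_ring_1 mat \<times> 'a mat \<Rightarrow> 'a mat \<Rightarrow> 'a mat" where
  "V_act m = (\<lambda>(g1, g2) v. del_last m g1 * v)"

definition V_dual_act :: "nat \<Rightarrow> 'a :: comm_ring_1 mat \<times> 'a mat \<Rightarrow> 'a mat \<Rightarrow> 'a mat" where
  "V_dual_act m = (\<lambda>(g1, g2) r. r * inv\<^bsub>unitriangular m\<^esub> (del_first g2))"

definition last_column :: "nat \<Rightarrow> 'a mat \<Rightarrow> 'a mat" where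
  "last_column m g = mat m 1 (\<lambda>(i, _). g $$ (i, m))"

definition first_row :: "nat \<Rightarrow> 'a mat \<Rightarrow> 'a mat" where
  "first_row m g = mat 1 m (\<lambda>(_, j). g $$ (0, j + 1))"

definition phi1 :: "nat \<Rightarrow> 'a :: comm_ring_1 mat \<times> 'a mat \<Rightarrow> 'a mat" where
  "phi1 m = (\<lambda>(g1, g2). last_column m g1)"

definition phi2 :: "nat \<Rightarrow> 'a :: comm_ring_1 mat \<times> 'a mat \<Rightarrow> 'a mat" where
  "phi2 m = (\<lambda>(g1, g2). first_row m g2 * inv\<^bsub>unitriangular m\<^esub> (del_first g2))"

end

theory Submission
  imports Defs
begin

text \<open>Write $g \in \mathbb U_{2m+1}$ in blocks of sizes $m, 1, m$, with diagonal blocks $A$, $1$, $B$,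
  corner $X$, and $a$, $b$ the remaining column and row above the diagonal. The product $g g'$ has
  corner $A X' + a b' + X B'$. So for the section that fills the corner with zeros, the corner of
  $s(g)\,s(h)$ is $\phi(g_1)\,\psi(h_2)$, while that of $\iota(X)\,s(gh)$ is
  $X\,\pi'(g_2 h_2)$; solving for $X$ gives the cup product cocycle itself, not merely a
  cohomologous one.\<close>

section \<open>Low-degree cohomology\<close>

text \<open>\<open>extension_class\<close> is a definite description, so it denotes nothing until
  the sections of the extension are known to share a single class. That independence is proved for
  an arbitrary abelian extension, and the matrices enter only through one convenient section.

  Inverses in \<open>E\<close> are awkward to compute, so identities between values in
  \<open>A\<close> are tested as identities \<open>\<iota> a * e = \<iota> b * e\<close> between
  products, with kernel elements pushed to the left. The convention for
  \<open>section_cocycle\<close> suits this.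

  The same convention explains the twist in \<open>phi2\<close>. Solving for the corner produces the
  inverse of \<pi>'(g2 h2), which is the inverse of \<pi>'(h2) times the inverse of \<pi>'(g2), in
  this order. The left factor is the one built into \<open>phi2 m h\<close>; the right factor is the
  action of g on row vectors. That the cup cochain satisfies the 2-cocycle condition also follows
  from its being the cocycle of a section.\<close>

lemma (in comm_group) cancel_middle:
  assumes "a \<in> carrier G" "b \<in> carrier G" "x \<in> carrier G"
  shows "a \<otimes> inv x \<otimes> (x \<otimes> b) = a \<otimes> b" "a \<otimes> x \<otimes> (inv x \<otimes> b) = a \<otimes> b"
proof -
  have "a \<otimes> inv x \<otimes> (x \<otimes> b) = a \<otimes> (inv x \<otimes> x) \<otimes> b"
    \<comment> \<open>With the inverse rules active, the inner pair would collapse before both sides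
      are reassociated to the same product.\<close>
    using assms by (simp add: m_assoc del: l_inv Units_l_inv)
  then show "a \<otimes> inv x \<otimes> (x \<otimes> b) = a \<otimes> b" using assms by simp
  have "a \<otimes> x \<otimes> (inv x \<otimes> b) = a \<otimes> (x \<otimes> inv x) \<otimes> b"
    using assms by (simp add: m_assoc del: r_inv Units_r_inv)
  then show "a \<otimes> x \<otimes> (inv x \<otimes> b) = a \<otimes> b" using assms by simp
qed

section \<open>The group of 2-cocycles and its subgroup of coboundaries\<close>

context group_module
begin

lemma act_group_hom: "g \<in> carrier G \<Longrightarrow> group_hom A A (act g)"
  by unfold_locales (auto simp: hom_def act_closed act_add)

lemma act_unit: "g \<in> carrier G \<Longrightarrow> act g \<one>\<^bsub>A\<^esub> = \<one>\<^bsub>A\<^esub>"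
  by (rule group_hom.hom_one[OF act_group_hom])

lemma act_inv:
  "\<lbrakk>g \<in> carrier G; a \<in> carrier A\<rbrakk> \<Longrightarrow> act g (inv\<^bsub>A\<^esub> a) = inv\<^bsub>A\<^esub> act g a"
  by (rule group_hom.hom_inv[OF act_group_hom])

lemma two_cocyclesI:
  assumes "f \<in> carrier G \<times> carrier G \<rightarrow>\<^sub>E carrier A"
    and "\<And>g h k. \<lbrakk>g \<in> carrier G; h \<in> carrier G; k \<in> carrier G\<rbrakk>
      \<Longrightarrow> act g (f (h, k)) \<otimes>\<^bsub>A\<^esub> f (g, h \<otimes> k) = f (g \<otimes> h, k) \<otimes>\<^bsub>A\<^esub> f (g, h)"
  shows "f \<in> carrier (two_cocycles G A act)"
  using assms unfolding two_cocycles_def by simp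

lemma two_cocycles_PiE:
  "f \<in> carrier (two_cocycles G A act) \<Longrightarrow> f \<in> carrier G \<times> carrier G \<rightarrow>\<^sub>E carrier A"
  unfolding two_cocycles_def by simp

lemma two_cocycles_closed:
  "\<lbrakk>f \<in> carrier (two_cocycles G A act); g \<in> carrier G; h \<in> carrier G\<rbrakk> \<Longrightarrow> f (g, h) \<in> carrier A"
  by (drule two_cocycles_PiE) auto

lemma two_cocycles_eq:
  "\<lbrakk>f \<in> carrier (two_cocycles G A act); g \<in> carrier G; h \<in> carrier G; k \<in> carrier G\<rbrakk>
    \<Longrightarrow> act g (f (h, k)) \<otimes>\<^bsub>A\<^esub> f (g, h \<otimes> k) = f (g \<otimes> h, k) \<otimes>\<^bsub>A\<^esub> f (g, h)"
  unfolding two_cocycles_def by simp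

text \<open>Cocycles are extensional: off \<open>carrier G \<times> carrier G\<close> they are all
  \<open>undefined\<close>, so only values on the carrier can differ.\<close>

lemma two_cocycles_ext:
  assumes "f \<in> carrier (two_cocycles G A act)" "f' \<in> carrier (two_cocycles G A act)"
    and "\<And>g h. \<lbrakk>g \<in> carrier G; h \<in> carrier G\<rbrakk> \<Longrightarrow> f (g, h) = f' (g, h)"
  shows "f = f'"
  using assms(3) by (intro PiE_ext[OF assms(1,2)[THEN two_cocycles_PiE]]) auto

lemma mult_two_cocycles:
  "\<lbrakk>g \<in> carrier G; h \<in> carrier G\<rbrakk>
    \<Longrightarrow> (f \<otimes>\<^bsub>two_cocycles G A act\<^esub> f') (g, h) = f (g, h) \<otimes>\<^bsub>A\<^esub> f' (g, h)"
  unfolding two_cocycles_def by simp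

lemma one_two_cocycles:
  "\<lbrakk>g \<in> carrier G; h \<in> carrier G\<rbrakk> \<Longrightarrow> \<one>\<^bsub>two_cocycles G A act\<^esub> (g, h) = \<one>\<^bsub>A\<^esub>"
  unfolding two_cocycles_def by simp

lemma mult_two_cocycles_closed:
  assumes f: "f \<in> carrier (two_cocycles G A act)" and f': "f' \<in> carrier (two_cocycles G A act)"
  shows "f \<otimes>\<^bsub>two_cocycles G A act\<^esub> f' \<in> carrier (two_cocycles G A act)"
proof (rule two_cocyclesI)
  show "f \<otimes>\<^bsub>two_cocycles G A act\<^esub> f' \<in> carrier G \<times> carrier G \<rightarrow>\<^sub>E carrier A"
    using two_cocycles_closed[OF f] two_cocycles_closed[OF f']
    \<comment> \<open>The second \<open>auto\<close> settles the arguments outside the carrier,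
      where the restricted product is \<open>undefined\<close>.\<close>
    by (auto simp: mult_two_cocycles) (auto simp: two_cocycles_def split: if_splits)
next
  fix g h k assume gs: "g \<in> carrier G" "h \<in> carrier G" "k \<in> carrier G"
  note closed = two_cocycles_closed[OF f] two_cocycles_closed[OF f'] act_closed
  have "act g (f (h, k)) \<otimes>\<^bsub>A\<^esub> act g (f' (h, k)) \<otimes>\<^bsub>A\<^esub> (f (g, h \<otimes> k) \<otimes>\<^bsub>A\<^esub> f' (g, h \<otimes> k))
    = (act g (f (h, k)) \<otimes>\<^bsub>A\<^esub> f (g, h \<otimes> k)) \<otimes>\<^bsub>A\<^esub> (act g (f' (h, k)) \<otimes>\<^bsub>A\<^esub> f' (g, h \<otimes> k))"
    using gs by (simp add: closed A.m_ac)
  also have "\<dots> = (f (g \<otimes> h, k) \<otimes>\<^bsub>A\<^esub> f (g, h)) \<otimes>\<^bsub>A\<^esub> (f' (g \<otimes> h, k) \<otimes>\<^bsub>A\<^esub> f' (g, h))"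
    using gs by (simp add: two_cocycles_eq[OF f] two_cocycles_eq[OF f'])
  also have "\<dots> = f (g \<otimes> h, k) \<otimes>\<^bsub>A\<^esub> f' (g \<otimes> h, k) \<otimes>\<^bsub>A\<^esub> (f (g, h) \<otimes>\<^bsub>A\<^esub> f' (g, h))"
    using gs by (simp add: closed A.m_ac)
  finally show "act g ((f \<otimes>\<^bsub>two_cocycles G A act\<^esub> f') (h, k))
      \<otimes>\<^bsub>A\<^esub> (f \<otimes>\<^bsub>two_cocycles G A act\<^esub> f') (g, h \<otimes> k)
    = (f \<otimes>\<^bsub>two_cocycles G A act\<^esub> f') (g \<otimes> h, k)
      \<otimes>\<^bsub>A\<^esub> (f \<otimes>\<^bsub>two_cocycles G A act\<^esub> f') (g, h)"
    using gs by (simp add: mult_two_cocycles act_add closed)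
qed

text \<open>Inversion in the commutative group \<open>A\<close> is an endomorphism commuting with
  the action, so it carries the cocycle identity over.\<close>

lemma inv_two_cocycles_closed:
  assumes f: "f \<in> carrier (two_cocycles G A act)"
  shows "(\<lambda>x\<in>carrier G \<times> carrier G. inv\<^bsub>A\<^esub> f x) \<in> carrier (two_cocycles G A act)"
proof (rule two_cocyclesI)
  show "(\<lambda>x\<in>carrier G \<times> carrier G. inv\<^bsub>A\<^esub> f x) \<in> carrier G \<times> carrier G \<rightarrow>\<^sub>E carrier A"
    using two_cocycles_closed[OF f] by auto
next
  fix g h k assume gs: "g \<in> carrier G" "h \<in> carrier G" "k \<in> carrier G"
  note closed = two_cocycles_closed[OF f] act_closed
  show "act g ((\<lambda>x\<in>carrier G \<times> carrier G. inv\<^bsub>A\<^esub> f x) (h, k))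
      \<otimes>\<^bsub>A\<^esub> (\<lambda>x\<in>carrier G \<times> carrier G. inv\<^bsub>A\<^esub> f x) (g, h \<otimes> k)
    = (\<lambda>x\<in>carrier G \<times> carrier G. inv\<^bsub>A\<^esub> f x) (g \<otimes> h, k)
      \<otimes>\<^bsub>A\<^esub> (\<lambda>x\<in>carrier G \<times> carrier G. inv\<^bsub>A\<^esub> f x) (g, h)"
    using gs two_cocycles_eq[OF f gs]
    by (simp add: act_inv closed A.inv_mult[symmetric])
qed

lemma one_two_cocycles_closed:
  "\<one>\<^bsub>two_cocycles G A act\<^esub> \<in> carrier (two_cocycles G A act)"
proof (rule two_cocyclesI)
  show "\<one>\<^bsub>two_cocycles G A act\<^esub> \<in> carrier G \<times> carrier G \<rightarrow>\<^sub>E carrier A"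
    unfolding two_cocycles_def by auto
qed (simp add: one_two_cocycles act_unit)

text \<open>The laws hold pointwise in \<open>A\<close>. The group structure is what makes
  \<open>H2_class\<close>, a right coset, independent of its representative.\<close>

lemma group_two_cocycles: "group (two_cocycles G A act)"
proof (rule groupI)
  fix f assume f: "f \<in> carrier (two_cocycles G A act)"
  note closed = two_cocycles_closed[OF f]
  let ?f' = "\<lambda>x\<in>carrier G \<times> carrier G. inv\<^bsub>A\<^esub> f x"
  show "\<one>\<^bsub>two_cocycles G A act\<^esub> \<otimes>\<^bsub>two_cocycles G A act\<^esub> f = f"
    by (rule two_cocycles_ext)
      (simp_all add: f mult_two_cocycles_closed one_two_cocycles_closed mult_two_cocycles
        one_two_cocycles closed)
  have "?f' \<otimes>\<^bsub>two_cocycles G A act\<^esub> f = \<one>\<^bsub>two_cocycles G A act\<^esub>"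
    by (rule two_cocycles_ext)
      (simp_all add: f inv_two_cocycles_closed mult_two_cocycles_closed one_two_cocycles_closed
        mult_two_cocycles one_two_cocycles closed)
  then show "\<exists>f'\<in>carrier (two_cocycles G A act).
      f' \<otimes>\<^bsub>two_cocycles G A act\<^esub> f = \<one>\<^bsub>two_cocycles G A act\<^esub>"
    using inv_two_cocycles_closed[OF f] by blast
next
  fix x y z
  assume x: "x \<in> carrier (two_cocycles G A act)" and y: "y \<in> carrier (two_cocycles G A act)"
    and z: "z \<in> carrier (two_cocycles G A act)"
  show "x \<otimes>\<^bsub>two_cocycles G A act\<^esub> y \<otimes>\<^bsub>two_cocycles G A act\<^esub> z
    = x \<otimes>\<^bsub>two_cocycles G A act\<^esub> (y \<otimes>\<^bsub>two_cocycles G A act\<^esub> z)"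
    by (rule two_cocycles_ext)
      (simp_all add: x y z mult_two_cocycles_closed mult_two_cocycles A.m_assoc
        two_cocycles_closed[OF x] two_cocycles_closed[OF y] two_cocycles_closed[OF z])
qed (simp_all add: mult_two_cocycles_closed one_two_cocycles_closed)

text \<open>Isolates the map whose image is \<open>two_coboundaries\<close>, so that the subgroup
  property can be read off from its compatibility with products.\<close>

definition coboundary :: "('g \<Rightarrow> 'a) \<Rightarrow> 'g \<times> 'g \<Rightarrow> 'a" where
  "coboundary c = (\<lambda>(g, h)\<in>carrier G \<times> carrier G.
     act g (c h) \<otimes>\<^bsub>A\<^esub> inv\<^bsub>A\<^esub> c (g \<otimes> h) \<otimes>\<^bsub>A\<^esub> c g)"

lemma two_coboundaries_eq: "two_coboundaries G A act = coboundary ` (carrier G \<rightarrow> carrier A)"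
  unfolding two_coboundaries_def coboundary_def by auto

lemma coboundary_apply:
  "\<lbrakk>g \<in> carrier G; h \<in> carrier G\<rbrakk>
    \<Longrightarrow> coboundary c (g, h) = act g (c h) \<otimes>\<^bsub>A\<^esub> inv\<^bsub>A\<^esub> c (g \<otimes> h) \<otimes>\<^bsub>A\<^esub> c g"
  unfolding coboundary_def by simp

text \<open>After expansion both sides equal the product of (gh).c(k), the inverse of c(ghk), g.c(h)
  and c(g): on the left the two occurrences of g.c(hk) cancel, on the right those of c(gh).\<close>

lemma coboundary_cocycle:
  assumes c: "c \<in> carrier G \<rightarrow> carrier A"
  shows "coboundary c \<in> carrier (two_cocycles G A act)"
proof (rule two_cocyclesI)
  note closed = Pi_mem[OF c] act_closed
  show "coboundary c \<in> carrier G \<times> carrier G \<rightarrow>\<^sub>E carrier A"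
    unfolding coboundary_def by (auto simp: closed)
  fix g h k assume gs: "g \<in> carrier G" "h \<in> carrier G" "k \<in> carrier G"
  have "act g (act h (c k) \<otimes>\<^bsub>A\<^esub> inv\<^bsub>A\<^esub> c (h \<otimes> k) \<otimes>\<^bsub>A\<^esub> c h)
      \<otimes>\<^bsub>A\<^esub> (act g (c (h \<otimes> k)) \<otimes>\<^bsub>A\<^esub> inv\<^bsub>A\<^esub> c (g \<otimes> (h \<otimes> k)) \<otimes>\<^bsub>A\<^esub> c g)
    = act g (act h (c k)) \<otimes>\<^bsub>A\<^esub> act g (c h) \<otimes>\<^bsub>A\<^esub> inv\<^bsub>A\<^esub> act g (c (h \<otimes> k))
      \<otimes>\<^bsub>A\<^esub> (act g (c (h \<otimes> k)) \<otimes>\<^bsub>A\<^esub> (inv\<^bsub>A\<^esub> c (g \<otimes> (h \<otimes> k)) \<otimes>\<^bsub>A\<^esub> c g))"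
    using gs by (simp add: closed act_add act_inv A.m_ac)
  also have "\<dots> = act g (act h (c k)) \<otimes>\<^bsub>A\<^esub> act g (c h) \<otimes>\<^bsub>A\<^esub> (inv\<^bsub>A\<^esub> c (g \<otimes> (h \<otimes> k)) \<otimes>\<^bsub>A\<^esub> c g)"
    using gs by (intro A.cancel_middle) (simp_all add: closed)
  also have "\<dots> = act g (act h (c k)) \<otimes>\<^bsub>A\<^esub> inv\<^bsub>A\<^esub> c (g \<otimes> (h \<otimes> k)) \<otimes>\<^bsub>A\<^esub> (act g (c h) \<otimes>\<^bsub>A\<^esub> c g)"
    using gs by (simp add: closed A.m_ac)
  \<comment> \<open>The pair formed by c(gh) and its inverse is inserted here; each of the two
    coboundary values on the right-hand side takes one of them.\<close>
  also have "\<dots> = act g (act h (c k)) \<otimes>\<^bsub>A\<^esub> inv\<^bsub>A\<^esub> c (g \<otimes> (h \<otimes> k)) \<otimes>\<^bsub>A\<^esub> c (g \<otimes> h)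
      \<otimes>\<^bsub>A\<^esub> (inv\<^bsub>A\<^esub> c (g \<otimes> h) \<otimes>\<^bsub>A\<^esub> (act g (c h) \<otimes>\<^bsub>A\<^esub> c g))"
    using gs by (intro A.cancel_middle(2)[symmetric]) (simp_all add: closed)
  also have "\<dots> = (act (g \<otimes> h) (c k) \<otimes>\<^bsub>A\<^esub> inv\<^bsub>A\<^esub> c (g \<otimes> h \<otimes> k) \<otimes>\<^bsub>A\<^esub> c (g \<otimes> h))
      \<otimes>\<^bsub>A\<^esub> (act g (c h) \<otimes>\<^bsub>A\<^esub> inv\<^bsub>A\<^esub> c (g \<otimes> h) \<otimes>\<^bsub>A\<^esub> c g)"
    using gs by (simp add: closed act_mult G.m_assoc A.m_ac)
  finally show "act g (coboundary c (h, k)) \<otimes>\<^bsub>A\<^esub> coboundary c (g, h \<otimes> k)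
    = coboundary c (g \<otimes> h, k) \<otimes>\<^bsub>A\<^esub> coboundary c (g, h)"
    using gs by (simp add: coboundary_apply)
qed

text \<open>Commutativity of \<open>A\<close> makes \<open>coboundary\<close> multiplicative in the
  cochain; closure of the coboundaries under products and inverses both come from this.\<close>

lemma coboundary_mult:
  assumes c: "c \<in> carrier G \<rightarrow> carrier A" and d: "d \<in> carrier G \<rightarrow> carrier A"
  shows "coboundary c \<otimes>\<^bsub>two_cocycles G A act\<^esub> coboundary d = coboundary (\<lambda>g. c g \<otimes>\<^bsub>A\<^esub> d g)"
proof (rule two_cocycles_ext)
  show "coboundary (\<lambda>g. c g \<otimes>\<^bsub>A\<^esub> d g) \<in> carrier (two_cocycles G A act)"
    using Pi_mem[OF c] Pi_mem[OF d] by (intro coboundary_cocycle) auto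
  show "coboundary c \<otimes>\<^bsub>two_cocycles G A act\<^esub> coboundary d \<in> carrier (two_cocycles G A act)"
    using c d by (intro mult_two_cocycles_closed coboundary_cocycle)
  fix g h assume "g \<in> carrier G" "h \<in> carrier G"
  then show "(coboundary c \<otimes>\<^bsub>two_cocycles G A act\<^esub> coboundary d) (g, h)
    = coboundary (\<lambda>g. c g \<otimes>\<^bsub>A\<^esub> d g) (g, h)"
    by (simp add: mult_two_cocycles coboundary_apply Pi_mem[OF c] Pi_mem[OF d] act_closed
        act_add A.inv_mult A.m_ac)
qed

lemma subgroup_two_coboundaries: "subgroup (two_coboundaries G A act) (two_cocycles G A act)"
proof -
  interpret Z: group "two_cocycles G A act" by (rule group_two_cocycles)
  show ?thesis
    unfolding two_coboundaries_eq
  proof (rule Z.subgroupI)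
    fix f assume "f \<in> coboundary ` (carrier G \<rightarrow> carrier A)"
    then obtain c where c: "c \<in> carrier G \<rightarrow> carrier A" and f: "f = coboundary c" by blast
    let ?d = "\<lambda>g. inv\<^bsub>A\<^esub> c g"
    have d: "?d \<in> carrier G \<rightarrow> carrier A" using Pi_mem[OF c] by simp
    \<comment> \<open>The product is the coboundary of a cochain that is constantly the unit on the
      carrier, and the action fixes the unit.\<close>
    have "coboundary ?d \<otimes>\<^bsub>two_cocycles G A act\<^esub> coboundary c = \<one>\<^bsub>two_cocycles G A act\<^esub>"
      unfolding coboundary_mult[OF d c]
    proof (rule two_cocycles_ext)
      show "coboundary (\<lambda>g. inv\<^bsub>A\<^esub> c g \<otimes>\<^bsub>A\<^esub> c g) \<in> carrier (two_cocycles G A act)"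
        using Pi_mem[OF c] by (intro coboundary_cocycle) simp
    qed (simp_all add: one_two_cocycles_closed one_two_cocycles coboundary_apply
        Pi_mem[OF c] act_unit)
    then have "inv\<^bsub>two_cocycles G A act\<^esub> f = coboundary ?d"
      unfolding f by (rule Z.inv_equality) (simp_all add: coboundary_cocycle c d)
    then show "inv\<^bsub>two_cocycles G A act\<^esub> f \<in> coboundary ` (carrier G \<rightarrow> carrier A)"
      using d by blast
  next
    fix f f'
    assume "f \<in> coboundary ` (carrier G \<rightarrow> carrier A)" "f' \<in> coboundary ` (carrier G \<rightarrow> carrier A)"
    then obtain c d where c: "c \<in> carrier G \<rightarrow> carrier A" "d \<in> carrier G \<rightarrow> carrier A"
      and f: "f = coboundary c" "f' = coboundary d" by blast
    have "(\<lambda>g. c g \<otimes>\<^bsub>A\<^esub> d g) \<in> carrier G \<rightarrow> carrier A"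
      using Pi_mem[OF c(1)] Pi_mem[OF c(2)] by simp
    then show "f \<otimes>\<^bsub>two_cocycles G A act\<^esub> f' \<in> coboundary ` (carrier G \<rightarrow> carrier A)"
      unfolding f coboundary_mult[OF c] by blast
  next
    have "(\<lambda>_. \<one>\<^bsub>A\<^esub>) \<in> carrier G \<rightarrow> carrier A" by simp
    then show "coboundary ` (carrier G \<rightarrow> carrier A) \<noteq> {}" by blast
  qed (auto simp: coboundary_cocycle)
qed

text \<open>The hypothesis says that f' is \<open>coboundary c\<close> times f, hence lies in the
  coset of f. It is written without inverses because a comparison of products in an extension yields
  it in this form.\<close>

lemma H2_class_eqI:
  assumes f: "f \<in> carrier (two_cocycles G A act)" and f': "f' \<in> carrier (two_cocycles G A act)"
    and c: "c \<in> carrier G \<rightarrow> carrier A"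
    and eq: "\<And>g h. \<lbrakk>g \<in> carrier G; h \<in> carrier G\<rbrakk>
      \<Longrightarrow> f' (g, h) \<otimes>\<^bsub>A\<^esub> c (g \<otimes> h) = c g \<otimes>\<^bsub>A\<^esub> act g (c h) \<otimes>\<^bsub>A\<^esub> f (g, h)"
  shows "H2_class G A act f = H2_class G A act f'"
proof -
  interpret Z: group "two_cocycles G A act" by (rule group_two_cocycles)
  note closed = Pi_mem[OF c] act_closed two_cocycles_closed[OF f] two_cocycles_closed[OF f']
  have "f' = coboundary c \<otimes>\<^bsub>two_cocycles G A act\<^esub> f"
  proof (rule two_cocycles_ext)
    fix g h assume gs: "g \<in> carrier G" "h \<in> carrier G"
    have "f' (g, h) = c g \<otimes>\<^bsub>A\<^esub> act g (c h) \<otimes>\<^bsub>A\<^esub> f (g, h) \<otimes>\<^bsub>A\<^esub> inv\<^bsub>A\<^esub> c (g \<otimes> h)"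
      using gs by (subst A.inv_solve_right) (simp_all add: closed eq)
    then show "f' (g, h) = (coboundary c \<otimes>\<^bsub>two_cocycles G A act\<^esub> f) (g, h)"
      using gs by (simp add: mult_two_cocycles coboundary_apply closed A.m_ac)
  qed (simp_all add: f f' c coboundary_cocycle)
  then have "f' \<in> two_coboundaries G A act #>\<^bsub>two_cocycles G A act\<^esub> f"
    using c unfolding two_coboundaries_eq r_coset_def by blast
  then show ?thesis
    unfolding H2_class_def using f by (rule Z.repr_independence[OF _ _ subgroup_two_coboundaries])
qed

lemma H2_class_closed:
  "f \<in> carrier (two_cocycles G A act) \<Longrightarrow> H2_class G A act f \<in> carrier (H2 G A act)"
  unfolding H2_def H2_class_def FactGroup_def RCOSETS_def by auto

end

section \<open>Cocycles of sections, and independence of the section\<close>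

context abelian_extension
begin

lemma \<iota>_closed: "a \<in> carrier A \<Longrightarrow> \<iota> a \<in> carrier E"
  using \<iota>_hom by (auto simp: hom_def)

lemma \<iota>_mult: "\<lbrakk>a \<in> carrier A; b \<in> carrier A\<rbrakk> \<Longrightarrow> \<iota> (a \<otimes>\<^bsub>A\<^esub> b) = \<iota> a \<otimes>\<^bsub>E\<^esub> \<iota> b"
  using \<iota>_hom by (auto simp: hom_def)

text \<open>The conjugation axiom freed of the inverse of e: a kernel element may pass to the left
  of e at the price of being acted on.\<close>

lemma \<iota>_conj:
  assumes "e \<in> carrier E" "a \<in> carrier A"
  shows "e \<otimes>\<^bsub>E\<^esub> \<iota> a = \<iota> (act (q e) a) \<otimes>\<^bsub>E\<^esub> e"
  using conj_act[OF assms, symmetric] assms by (simp add: \<iota>_closed E.m_assoc)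

text \<open>The way back from \<open>E\<close> to \<open>A\<close>: an identity of cocycle values is
  proved by multiplying its image by a common section value.\<close>

lemma \<iota>_mult_cancel:
  assumes "a \<in> carrier A" "b \<in> carrier A" "e \<in> carrier E"
    and "\<iota> a \<otimes>\<^bsub>E\<^esub> e = \<iota> b \<otimes>\<^bsub>E\<^esub> e"
  shows "a = b"
  using assms \<iota>_inj by (simp add: \<iota>_closed inj_on_eq_iff)

text \<open>By exactness, elements with the same image under q differ by an element of the image of
  \<open>\<iota>\<close>, so \<open>inv_into\<close> is applied to a point where it is a genuine
  preimage.\<close>

lemma fibre_\<iota>:
  assumes "x \<in> carrier E" "y \<in> carrier E" "q x = q y"
  shows "inv_into (carrier A) \<iota> (x \<otimes>\<^bsub>E\<^esub> inv\<^bsub>E\<^esub> y) \<in> carrier A"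
    and "\<iota> (inv_into (carrier A) \<iota> (x \<otimes>\<^bsub>E\<^esub> inv\<^bsub>E\<^esub> y)) \<otimes>\<^bsub>E\<^esub> y = x"
proof -
  interpret q: group_hom E G q
    using q_hom by unfold_locales
  have "x \<otimes>\<^bsub>E\<^esub> inv\<^bsub>E\<^esub> y \<in> kernel E G q"
    using assms by (simp add: kernel_def)
  then have *: "x \<otimes>\<^bsub>E\<^esub> inv\<^bsub>E\<^esub> y \<in> \<iota> ` carrier A"
    using exact by simp
  then show "inv_into (carrier A) \<iota> (x \<otimes>\<^bsub>E\<^esub> inv\<^bsub>E\<^esub> y) \<in> carrier A"
    by (rule inv_into_into)
  show "\<iota> (inv_into (carrier A) \<iota> (x \<otimes>\<^bsub>E\<^esub> inv\<^bsub>E\<^esub> y)) \<otimes>\<^bsub>E\<^esub> y = x"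
    using assms by (simp add: f_inv_into_f[OF *] E.m_assoc)
qed

context
  fixes s
  assumes s: "s \<in> set_sections G E q"
begin

lemma section_closed: "g \<in> carrier G \<Longrightarrow> s g \<in> carrier E"
  using s by (auto simp: set_sections_def)

lemma section_proj: "g \<in> carrier G \<Longrightarrow> q (s g) = g"
  using s by (auto simp: set_sections_def)

text \<open>Both s(g) s(h) and s(gh) lie over gh. The product relation determines the cocycle, and
  later arguments use it in place of the definition by \<open>inv_into\<close>.\<close>

lemma
  assumes "g \<in> carrier G" "h \<in> carrier G"
  shows section_cocycle_closed: "section_cocycle G A E \<iota> s (g, h) \<in> carrier A"
    and section_mult:
      "s g \<otimes>\<^bsub>E\<^esub> s h = \<iota> (section_cocycle G A E \<iota> s (g, h)) \<otimes>\<^bsub>E\<^esub> s (g \<otimes> h)"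
proof -
  have "q (s g \<otimes>\<^bsub>E\<^esub> s h) = q (s (g \<otimes> h))"
    using assms q_hom by (simp add: section_closed section_proj hom_mult)
  from fibre_\<iota>[OF _ _ this] assms
  show "section_cocycle G A E \<iota> s (g, h) \<in> carrier A"
    "s g \<otimes>\<^bsub>E\<^esub> s h = \<iota> (section_cocycle G A E \<iota> s (g, h)) \<otimes>\<^bsub>E\<^esub> s (g \<otimes> h)"
    by (simp_all add: section_cocycle_def section_closed)
qed

text \<open>The cocycle identity is associativity of s(g) s(h) s(k): each bracketing is brought to
  the form of a kernel element times s(ghk).\<close>

lemma section_cocycle_cocycle: "section_cocycle G A E \<iota> s \<in> carrier (two_cocycles G A act)"
proof (rule two_cocyclesI)
  let ?f = "section_cocycle G A E \<iota> s"
  note closed = section_cocycle_closed section_closed act_closed \<iota>_closed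
  show "?f \<in> carrier G \<times> carrier G \<rightarrow>\<^sub>E carrier A"
    by (auto simp: closed) (auto simp: section_cocycle_def split: if_splits)
  fix g h k assume gs: "g \<in> carrier G" "h \<in> carrier G" "k \<in> carrier G"
  have "\<iota> (act g (?f (h, k)) \<otimes>\<^bsub>A\<^esub> ?f (g, h \<otimes> k)) \<otimes>\<^bsub>E\<^esub> s (g \<otimes> h \<otimes> k)
    = \<iota> (act g (?f (h, k))) \<otimes>\<^bsub>E\<^esub> (s g \<otimes>\<^bsub>E\<^esub> s (h \<otimes> k))"
    using gs by (simp add: closed \<iota>_mult E.m_assoc G.m_assoc section_mult)
  \<comment> \<open>The kernel element for (h, k) crosses s(g), which accounts for the action in the
    cocycle identity.\<close>
  also have "\<dots> = s g \<otimes>\<^bsub>E\<^esub> (\<iota> (?f (h, k)) \<otimes>\<^bsub>E\<^esub> s (h \<otimes> k))"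
    using gs \<iota>_conj[of "s g" "?f (h, k)"]
    by (simp add: closed section_proj E.m_assoc[symmetric])
  also have "\<dots> = s g \<otimes>\<^bsub>E\<^esub> s h \<otimes>\<^bsub>E\<^esub> s k"
    using gs by (simp add: closed section_mult[symmetric] E.m_assoc)
  also have "\<dots> = \<iota> (?f (g, h)) \<otimes>\<^bsub>E\<^esub> (s (g \<otimes> h) \<otimes>\<^bsub>E\<^esub> s k)"
    using gs by (simp add: section_mult closed E.m_assoc)
  also have "\<dots> = \<iota> (?f (g \<otimes> h, k) \<otimes>\<^bsub>A\<^esub> ?f (g, h)) \<otimes>\<^bsub>E\<^esub> s (g \<otimes> h \<otimes> k)"
    \<comment> \<open>The bracketing on the left produces the values at (g, h) and (gh, k) in this
      order; the definition of \<open>two_cocycles\<close> has them swapped.\<close>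
    using gs by (subst A.m_comm) (simp_all add: section_mult closed \<iota>_mult E.m_assoc)
  finally show "act g (?f (h, k)) \<otimes>\<^bsub>A\<^esub> ?f (g, h \<otimes> k) = ?f (g \<otimes> h, k) \<otimes>\<^bsub>A\<^esub> ?f (g, h)"
    using gs by (rule_tac \<iota>_mult_cancel[of _ _ "s (g \<otimes> h \<otimes> k)"]) (simp_all add: closed)
qed

text \<open>Allows a cocycle value to be guessed and then verified by one product equation in
  \<open>E\<close>, with no inverse of a section value to compute.\<close>

lemma section_cocycleI:
  assumes "g \<in> carrier G" "h \<in> carrier G" "a \<in> carrier A"
    and "s g \<otimes>\<^bsub>E\<^esub> s h = \<iota> a \<otimes>\<^bsub>E\<^esub> s (g \<otimes> h)"
  shows "section_cocycle G A E \<iota> s (g, h) = a"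
  using assms section_mult[of g h]
  by (intro \<iota>_mult_cancel[of _ _ "s (g \<otimes> h)"])
    (simp_all add: section_cocycle_closed section_closed)

end

text \<open>Two sections differ by a cochain c with values in \<open>A\<close>, and the coboundary
  of c is the quotient of their cocycles.\<close>

lemma H2_class_section_cocycle_eq:
  assumes s: "s \<in> set_sections G E q" and s': "s' \<in> set_sections G E q"
  shows "H2_class G A act (section_cocycle G A E \<iota> s) = H2_class G A act (section_cocycle G A E \<iota> s')"
proof -
  let ?f = "section_cocycle G A E \<iota> s" and ?f' = "section_cocycle G A E \<iota> s'"
  define c where "c g = inv_into (carrier A) \<iota> (s' g \<otimes>\<^bsub>E\<^esub> inv\<^bsub>E\<^esub> s g)" for g
  have c: "c g \<in> carrier A" "\<iota> (c g) \<otimes>\<^bsub>E\<^esub> s g = s' g" if "g \<in> carrier G" for g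
    unfolding c_def using that s s'
    by (auto intro!: fibre_\<iota> simp: section_closed section_proj)
  note closed = section_closed[OF s] section_closed[OF s'] act_closed \<iota>_closed c(1)
    section_cocycle_closed[OF s] section_cocycle_closed[OF s']
  show ?thesis
  proof (rule H2_class_eqI[of _ _ c])
    show "?f \<in> carrier (two_cocycles G A act)" "?f' \<in> carrier (two_cocycles G A act)"
      using s s' by (simp_all add: section_cocycle_cocycle)
    show "c \<in> carrier G \<rightarrow> carrier A" using c by simp
    fix g h assume gs: "g \<in> carrier G" "h \<in> carrier G"
    have "\<iota> (?f' (g, h) \<otimes>\<^bsub>A\<^esub> c (g \<otimes> h)) \<otimes>\<^bsub>E\<^esub> s (g \<otimes> h) = s' g \<otimes>\<^bsub>E\<^esub> s' h"
      using gs by (simp add: closed \<iota>_mult E.m_assoc c(2) section_mult[OF s'])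
    also have "\<dots> = \<iota> (c g) \<otimes>\<^bsub>E\<^esub> (s g \<otimes>\<^bsub>E\<^esub> \<iota> (c h)) \<otimes>\<^bsub>E\<^esub> s h"
      using gs by (simp add: c(2)[symmetric] closed E.m_assoc)
    \<comment> \<open>Moving the correction at h past s(g) turns it into its translate under g, the
      acted-on term of the coboundary.\<close>
    also have "\<dots> = \<iota> (c g) \<otimes>\<^bsub>E\<^esub> \<iota> (act g (c h)) \<otimes>\<^bsub>E\<^esub> (s g \<otimes>\<^bsub>E\<^esub> s h)"
      using gs \<iota>_conj[of "s g" "c h"] by (simp add: section_proj[OF s] closed E.m_assoc)
    also have "\<dots> = \<iota> (c g \<otimes>\<^bsub>A\<^esub> act g (c h) \<otimes>\<^bsub>A\<^esub> ?f (g, h)) \<otimes>\<^bsub>E\<^esub> s (g \<otimes> h)"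
      using gs by (simp add: section_mult[OF s] closed E.m_assoc \<iota>_mult)
    finally show "?f' (g, h) \<otimes>\<^bsub>A\<^esub> c (g \<otimes> h) = c g \<otimes>\<^bsub>A\<^esub> act g (c h) \<otimes>\<^bsub>A\<^esub> ?f (g, h)"
      using gs by (rule_tac \<iota>_mult_cancel[of _ _ "s (g \<otimes> h)"]) (simp_all add: closed)
  qed
qed

text \<open>Existence and uniqueness for the definite description, so that the class may be computed
  from any section at hand.\<close>

lemma extension_class_eq:
  assumes "s \<in> set_sections G E q"
  shows "extension_class G A act E \<iota> q = H2_class G A act (section_cocycle G A E \<iota> s)"
  unfolding extension_class_def
proof (rule the_equality)
  show "\<exists>s'\<in>set_sections G E q.
      H2_class G A act (section_cocycle G A E \<iota> s) = H2_class G A act (section_cocycle G A E \<iota> s')"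
    by (intro bexI[of _ s] refl assms)
  fix c assume "\<exists>s'\<in>set_sections G E q. c = H2_class G A act (section_cocycle G A E \<iota> s')"
  then show "c = H2_class G A act (section_cocycle G A E \<iota> s)"
    using H2_class_section_cocycle_eq[OF assms] by auto
qed

end

section \<open>Unitriangular groups\<close>

text \<open>An explicit sum, from which single summands can be split off. The default rule
  \<open>index_mult_mat(1)\<close> gives a scalar product of a row and a column instead, and is
  therefore disabled wherever this form is wanted.\<close>

lemma mult_mat_index:
  assumes "A \<in> carrier_mat a b" "B \<in> carrier_mat b c" "i < a" "j < c"
  shows "(A * B) $$ (i, j) = (\<Sum>k<b. A $$ (i, k) * B $$ (k, j))"
  using assms by (auto simp: scalar_prod_def lessThan_atLeast0 intro!: sum.cong)

lemma sum_lessThan_add: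
  fixes f :: "nat \<Rightarrow> 'a :: comm_monoid_add"
  shows "(\<Sum>k<a + b. f k) = (\<Sum>k<a. f k) + (\<Sum>k<b. f (a + k))"
  by (induction b) (simp_all add: add.assoc)

lemma unitriangular_simps [simp]:
  "mult (unitriangular k) = (*)" "one (unitriangular k) = 1\<^sub>m k"
  unfolding unitriangular_def by simp_all

lemma unitriangularI:
  assumes "g \<in> carrier_mat k k"
    and "\<And>i j. \<lbrakk>j < i; i < k\<rbrakk> \<Longrightarrow> g $$ (i, j) = 0" and "\<And>i. i < k \<Longrightarrow> g $$ (i, i) = 1"
  shows "g \<in> carrier (unitriangular k)"
  using assms unfolding unitriangular_def by auto

lemma
  assumes "g \<in> carrier (unitriangular k)"
  shows unitriangular_mat: "g \<in> carrier_mat k k"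
    and unitriangular_below: "\<lbrakk>j < i; i < k\<rbrakk> \<Longrightarrow> g $$ (i, j) = 0"
    and unitriangular_diag: "i < k \<Longrightarrow> g $$ (i, i) = 1"
  using assms unfolding unitriangular_def by auto

lemma unitriangular_mult_closed:
  assumes g: "g \<in> carrier (unitriangular k)" and h: "h \<in> carrier (unitriangular k)"
  shows "g * h \<in> carrier (unitriangular k)"
proof (rule unitriangularI)
  note mats = unitriangular_mat[OF g] unitriangular_mat[OF h]
  show "g * h \<in> carrier_mat k k" using mats by simp
  fix i assume i: "i < k"
  have "(g * h) $$ (i, i) = (\<Sum>l<k. if l = i then 1 else 0)"
    unfolding mult_mat_index[OF mats i i]
  proof (rule sum.cong)
    fix l assume "l \<in> {..<k}"
    then show "g $$ (i, l) * h $$ (l, i) = (if l = i then 1 else 0)"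
      using i unitriangular_below[OF g, of l i] unitriangular_below[OF h, of i l]
      by (cases l i rule: linorder_cases) (auto simp: unitriangular_diag[OF g] unitriangular_diag[OF h])
  qed simp
  then show "(g * h) $$ (i, i) = 1" using i by simp
  fix j assume j: "j < i"
  have "g $$ (i, l) * h $$ (l, j) = 0" if "l < k" for l
    using that i j unitriangular_below[OF g, of l i] unitriangular_below[OF h, of j l]
    by (cases "l < i") auto
  then show "(g * h) $$ (i, j) = 0"
    using i j by (subst mult_mat_index[OF mats]) auto
qed

text \<open>The determinant is 1, so the adjugate is a left inverse h. Its shape is read off from
  \<open>h * g = 1\<close>: within a row of h, the entries up to the diagonal are determined from
  left to right.\<close>

lemma unitriangular_left_inverse:
  fixes g :: "'a :: comm_ring_1 mat"
  assumes g: "g \<in> carrier (unitriangular k)"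
  shows "\<exists>h \<in> carrier (unitriangular k). h * g = 1\<^sub>m k"
proof -
  note mat = unitriangular_mat[OF g]
  have "diag_mat g = map (\<lambda>_. 1) [0..<k]"
    unfolding diag_mat_def using mat unitriangular_diag[OF g] by auto
  then have "prod_list (diag_mat g) = 1"
    by (simp add: map_replicate_const)
  moreover have "upper_triangular g"
    using g unfolding unitriangular_def by simp
  ultimately have "det g = 1"
    using det_upper_triangular mat by metis
  define h where "h = adj_mat g"
  have h: "h \<in> carrier_mat k k" and hg: "h * g = 1\<^sub>m k"
    unfolding h_def using adj_mat[OF mat] \<open>det g = 1\<close> by auto
  have entry: "h $$ (i, j) = (if i = j then 1 else 0)" if "j \<le> i" "i < k" for i j
    using that
  proof (induction j rule: less_induct)
    case (less j)
    have "(1\<^sub>m k :: 'a mat) $$ (i, j) = (\<Sum>l<k. h $$ (i, l) * g $$ (l, j))"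
      unfolding hg[symmetric] using less.prems by (intro mult_mat_index[OF h mat]) auto
    also have "\<dots> = (\<Sum>l<k. if l = j then h $$ (i, j) else 0)"
    proof (rule sum.cong)
      fix l assume "l \<in> {..<k}"
      then show "h $$ (i, l) * g $$ (l, j) = (if l = j then h $$ (i, j) else 0)"
        \<comment> \<open>For l < j the entry of h vanishes by induction, because l < j \<le> i
          keeps it off the diagonal; for l > j the entry of g vanishes.\<close>
        using less.prems less.IH[of l] unitriangular_below[OF g, of j l]
        by (cases l j rule: linorder_cases) (auto simp: unitriangular_diag[OF g])
    qed simp
    also have "\<dots> = h $$ (i, j)" using less.prems by simp
    finally show ?case using less.prems by (simp split: if_splits)
  qed
  have "h \<in> carrier (unitriangular k)"
    using h entry by (intro unitriangularI) auto
  with hg show ?thesis by blast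
qed

lemma group_unitriangular: "group (unitriangular k :: 'a :: comm_ring_1 mat monoid)"
proof (rule groupI)
  show "\<one>\<^bsub>unitriangular k\<^esub> \<in> carrier (unitriangular k :: 'a mat monoid)"
    by (rule unitriangularI) auto
qed (auto simp: unitriangular_mult_closed unitriangular_left_inverse unitriangular_mat
    assoc_mult_mat[OF unitriangular_mat unitriangular_mat unitriangular_mat]
    left_mult_one_mat[OF unitriangular_mat])

lemma monoid_mat_simps [simp]:
  "carrier (monoid_mat ty r c) = carrier_mat r c"
  "mult (monoid_mat ty r c) = (+)"
  "one (monoid_mat ty r c) = 0\<^sub>m r c"
  unfolding monoid_mat_def by simp_all

section \<open>Deleting a border row and column; last columns and first rows\<close>

lemma del_last_mat: "g \<in> carrier_mat (m + 1) (m + 1) \<Longrightarrow> del_last m g \<in> carrier_mat m m"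
  unfolding del_last_def mat_delete_def by auto

lemma del_first_mat: "g \<in> carrier_mat (m + 1) (m + 1) \<Longrightarrow> del_first g \<in> carrier_mat m m"
  unfolding del_first_def mat_delete_def by auto

lemma del_last_index:
  "\<lbrakk>g \<in> carrier_mat (m + 1) (m + 1); i < m; j < m\<rbrakk> \<Longrightarrow> del_last m g $$ (i, j) = g $$ (i, j)"
  unfolding del_last_def mat_delete_def by auto

lemma del_first_index:
  "\<lbrakk>g \<in> carrier_mat (m + 1) (m + 1); i < m; j < m\<rbrakk>
    \<Longrightarrow> del_first g $$ (i, j) = g $$ (i + 1, j + 1)"
  unfolding del_first_def mat_delete_def by auto

lemma last_column_mat [simp]: "last_column m g \<in> carrier_mat m 1"
  unfolding last_column_def by simp

lemma first_row_mat [simp]: "first_row m g \<in> carrier_mat 1 m"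
  unfolding first_row_def by simp

lemma last_column_dim [simp]: "dim_row (last_column m g) = m" "dim_col (last_column m g) = 1"
  unfolding last_column_def by simp_all

lemma first_row_dim [simp]: "dim_row (first_row m g) = 1" "dim_col (first_row m g) = m"
  unfolding first_row_def by simp_all

lemma last_column_index: "i < m \<Longrightarrow> last_column m g $$ (i, 0) = g $$ (i, m)"
  unfolding last_column_def by simp

lemma first_row_index: "j < m \<Longrightarrow> first_row m g $$ (0, j) = g $$ (0, j + 1)"
  unfolding first_row_def by simp

lemma last_column_one [simp]: "last_column m (1\<^sub>m (m + 1)) = 0\<^sub>m m 1"
  unfolding last_column_def by auto

lemma first_row_one [simp]: "first_row m (1\<^sub>m (m + 1)) = 0\<^sub>m 1 m"
  unfolding first_row_def by auto

lemma del_last_one [simp]: "del_last m (1\<^sub>m (m + 1)) = 1\<^sub>m m"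
  by (rule eq_matI) (auto simp: del_last_index, auto simp: del_last_def)

lemma del_first_one [simp]: "del_first (1\<^sub>m (m + 1)) = 1\<^sub>m m"
  by (rule eq_matI) (auto simp: del_first_index[of _ m], auto simp: del_first_def)

lemma del_last_closed:
  assumes "g \<in> carrier (unitriangular (m + 1))"
  shows "del_last m g \<in> carrier (unitriangular m)"
  using unitriangular_mat[OF assms] unitriangular_below[OF assms] unitriangular_diag[OF assms]
  by (intro unitriangularI) (simp_all add: del_last_mat del_last_index)

lemma del_first_closed:
  assumes "g \<in> carrier (unitriangular (m + 1))"
  shows "del_first g \<in> carrier (unitriangular m)"
  using unitriangular_mat[OF assms] unitriangular_below[OF assms] unitriangular_diag[OF assms]
  by (intro unitriangularI) (simp_all add: del_first_mat del_first_index)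

context
  fixes m :: nat and g h :: "'a :: comm_ring_1 mat"
  assumes g: "g \<in> carrier (unitriangular (m + 1))" and h: "h \<in> carrier (unitriangular (m + 1))"
begin

text \<open>The summand with index m drops out, as row m of h vanishes left of the diagonal.\<close>

lemma del_last_mult: "del_last m (g * h) = del_last m g * del_last m h"
proof (rule eq_matI)
  note mats = unitriangular_mat[OF g] unitriangular_mat[OF h]
  show "dim_row (del_last m (g * h)) = dim_row (del_last m g * del_last m h)"
    "dim_col (del_last m (g * h)) = dim_col (del_last m g * del_last m h)"
    using mats by (simp_all add: del_last_def)
  fix i j assume "i < dim_row (del_last m g * del_last m h)" "j < dim_col (del_last m g * del_last m h)"
  then have ij: "i < m" "j < m" using mats by (simp_all add: del_last_def)
  then show "del_last m (g * h) $$ (i, j) = (del_last m g * del_last m h) $$ (i, j)"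
    using mats unitriangular_below[OF h, of j m]
    by (simp add: del_last_index mult_mat_index[OF mats] mult_mat_index[OF del_last_mat del_last_mat]
        del: index_mult_mat(1))
qed

text \<open>The summand with index 0 drops out, as column 0 of g vanishes below the
  diagonal.\<close>

lemma del_first_mult: "del_first (g * h) = del_first g * del_first h"
proof (rule eq_matI)
  note mats = unitriangular_mat[OF g] unitriangular_mat[OF h]
  show "dim_row (del_first (g * h)) = dim_row (del_first g * del_first h)"
    "dim_col (del_first (g * h)) = dim_col (del_first g * del_first h)"
    using mats by (simp_all add: del_first_def)
  fix i j assume "i < dim_row (del_first g * del_first h)" "j < dim_col (del_first g * del_first h)"
  then have ij: "i < m" "j < m" using mats by (simp_all add: del_first_def)
  then show "del_first (g * h) $$ (i, j) = (del_first g * del_first h) $$ (i, j)"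
    using mats unitriangular_below[OF g, of 0 "i + 1"]
    by (simp add: del_first_index[of _ m] mult_mat_index[OF mats]
        mult_mat_index[OF del_first_mat del_first_mat] sum.lessThan_Suc_shift
        del: sum.lessThan_Suc index_mult_mat(1))
qed

text \<open>The free term comes from the diagonal entry 1 of h at m. This is already the cocycle
  identity for \<open>phi1\<close>.\<close>

lemma last_column_mult: "last_column m (g * h) = last_column m g + del_last m g * last_column m h"
proof (rule eq_matI)
  note mats = unitriangular_mat[OF g] unitriangular_mat[OF h]
  fix i j assume "i < dim_row (last_column m g + del_last m g * last_column m h)"
    "j < dim_col (last_column m g + del_last m g * last_column m h)"
  then have ij: "i < m" "j = 0" using mats by (simp_all add: del_last_def last_column_def)
  then show "last_column m (g * h) $$ (i, j)
    = (last_column m g + del_last m g * last_column m h) $$ (i, j)"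
    using mats unitriangular_diag[OF h, of m]
    by (simp add: del_last_index last_column_index mult_mat_index[OF mats]
        mult_mat_index[OF del_last_mat last_column_mat] del_last_mat[THEN carrier_matD(1)]
        del: index_mult_mat(1))
qed (use unitriangular_mat[OF g] in \<open>simp_all add: del_last_def last_column_def\<close>)

text \<open>The free term comes from the diagonal entry 1 of g at 0. Here h acts from the right; the
  inverse factor in \<open>phi2\<close> turns this into a cocycle identity for a left
  action.\<close>

lemma first_row_mult: "first_row m (g * h) = first_row m h + first_row m g * del_first h"
proof (rule eq_matI)
  note mats = unitriangular_mat[OF g] unitriangular_mat[OF h]
  fix i j assume "i < dim_row (first_row m h + first_row m g * del_first h)"
    "j < dim_col (first_row m h + first_row m g * del_first h)"
  then have ij: "i = 0" "j < m" using mats by (simp_all add: del_first_def first_row_def)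
  then show "first_row m (g * h) $$ (i, j)
    = (first_row m h + first_row m g * del_first h) $$ (i, j)"
    using mats unitriangular_diag[OF g, of 0]
    by (simp add: del_first_index[of _ m] first_row_index mult_mat_index[OF mats]
        mult_mat_index[OF first_row_mat del_first_mat] del_first_mat[THEN carrier_matD(2)]
        sum.lessThan_Suc_shift del: sum.lessThan_Suc index_mult_mat(1))
qed (use unitriangular_mat[OF h] in \<open>simp_all add: del_first_def first_row_def\<close>)

end

section \<open>The block extension\<close>

abbreviation block_group :: "nat \<Rightarrow> ('a :: comm_ring_1 mat \<times> 'a mat) monoid" where
  "block_group m \<equiv> unitriangular (m + 1) \<times>\<times> unitriangular (m + 1)"

lemma group_block_group: "group (block_group m)"
  by (intro DirProd_group group_unitriangular)

section \<open>Coordinates on a unitriangular matrix: two diagonal blocks and a corner\<close>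

definition corner :: "nat \<Rightarrow> 'a mat \<Rightarrow> 'a mat" where
  "corner m g = mat m m (\<lambda>(i, j). g $$ (i, m + 1 + j))"

text \<open>One construction for two purposes: corner 0 gives the section, identity blocks give
  \<open>S_embed\<close>. The two diagonal blocks overlap only at (m, m), where the entry of the
  left component is taken.\<close>

definition assemble :: "nat \<Rightarrow> 'a :: zero mat \<times> 'a mat \<Rightarrow> 'a mat \<Rightarrow> 'a mat" where
  "assemble m g X = mat (2 * m + 1) (2 * m + 1) (\<lambda>(i, j).
     if i < m \<and> m < j then X $$ (i, j - (m + 1))
     else if i \<le> m \<and> j \<le> m then fst g $$ (i, j)
     else if m \<le> i \<and> m \<le> j then snd g $$ (i - m, j - m)
     else 0)"

lemma corner_mat [simp]: "corner m g \<in> carrier_mat m m"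
  unfolding corner_def by simp

lemma corner_dim [simp]: "dim_row (corner m g) = m" "dim_col (corner m g) = m"
  unfolding corner_def by simp_all

lemma corner_index: "\<lbrakk>i < m; j < m\<rbrakk> \<Longrightarrow> corner m g $$ (i, j) = g $$ (i, m + 1 + j)"
  unfolding corner_def by simp

lemma top_left_mat: "top_left m g \<in> carrier_mat (m + 1) (m + 1)"
  unfolding top_left_def by simp

lemma bottom_right_mat: "bottom_right m g \<in> carrier_mat (m + 1) (m + 1)"
  unfolding bottom_right_def by simp

lemma top_left_index: "\<lbrakk>i \<le> m; j \<le> m\<rbrakk> \<Longrightarrow> top_left m g $$ (i, j) = g $$ (i, j)"
  unfolding top_left_def by simp

lemma bottom_right_index:
  "\<lbrakk>i \<le> m; j \<le> m\<rbrakk> \<Longrightarrow> bottom_right m g $$ (i, j) = g $$ (i + m, j + m)"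
  unfolding bottom_right_def by simp

lemma assemble_closed:
  assumes g: "g \<in> carrier (block_group m)"
  shows "assemble m g X \<in> carrier (unitriangular (2 * m + 1))"
proof (rule unitriangularI)
  have fst: "fst g \<in> carrier (unitriangular (m + 1))" and snd: "snd g \<in> carrier (unitriangular (m + 1))"
    using g by auto
  show "assemble m g X \<in> carrier_mat (2 * m + 1) (2 * m + 1)"
    unfolding assemble_def by simp
  show "assemble m g X $$ (i, i) = 1" if "i < 2 * m + 1" for i
    using that unfolding assemble_def
    by (simp add: unitriangular_diag[OF fst] unitriangular_diag[OF snd])
  show "assemble m g X $$ (i, j) = 0" if "j < i" "i < 2 * m + 1" for i j
    using that unfolding assemble_def
    by (auto simp: unitriangular_below[OF fst] unitriangular_below[OF snd])
qed

lemma corner_assemble: "X \<in> carrier_mat m m \<Longrightarrow> corner m (assemble m g X) = X"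
  unfolding corner_def assemble_def by (rule eq_matI) auto

lemma block_proj_assemble:
  assumes g: "g \<in> carrier (block_group m)"
  shows "block_proj m (assemble m g X) = g"
proof -
  have fst: "fst g \<in> carrier (unitriangular (m + 1))" and snd: "snd g \<in> carrier (unitriangular (m + 1))"
    using g by auto
  have "top_left m (assemble m g X) = fst g"
    using unitriangular_mat[OF fst] unfolding top_left_def assemble_def by (intro eq_matI) auto
  moreover have "bottom_right m (assemble m g X) = snd g"
  proof (rule eq_matI)
    fix i j assume "i < dim_row (snd g)" "j < dim_col (snd g)"
    then have "i \<le> m" "j \<le> m" using unitriangular_mat[OF snd] by auto
    then show "bottom_right m (assemble m g X) $$ (i, j) = snd g $$ (i, j)"
      \<comment> \<open>At the shared entry (m, m) the assembled matrix has the last diagonal entry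
        of \<open>fst g\<close>, which agrees with the first one of \<open>snd g\<close> since both
        are 1.\<close>
      using unitriangular_diag[OF fst, of m] unitriangular_diag[OF snd, of 0]
        unitriangular_below[OF snd, of 0 i]
      unfolding bottom_right_def assemble_def by auto
  qed (use unitriangular_mat[OF snd] in \<open>auto simp: bottom_right_def\<close>)
  ultimately show ?thesis unfolding block_proj_def by simp
qed

text \<open>The two blocks, the corner and the zeros below the diagonal cover all entries. Equations
  between products can thus be checked in the quotient and in the corner, without touching entries
  again.\<close>

lemma unitriangular_block_eqI:
  assumes g: "g \<in> carrier (unitriangular (2 * m + 1))" and h: "h \<in> carrier (unitriangular (2 * m + 1))"
    and proj: "block_proj m g = block_proj m h" and corner: "corner m g = corner m h"
  shows "g = h"
proof (rule eq_matI)
  note mats = unitriangular_mat[OF g] unitriangular_mat[OF h]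
  show "dim_row g = dim_row h" "dim_col g = dim_col h" using mats by auto
  fix i j assume "i < dim_row h" "j < dim_col h"
  then have ij: "i < 2 * m + 1" "j < 2 * m + 1" using mats by auto
  consider "j < i" | "i \<le> m" "j \<le> m" | "m \<le> i" "m \<le> j" | "i < m" "m < j" by linarith
  then show "g $$ (i, j) = h $$ (i, j)"
  proof cases
    case 1
    then show ?thesis using ij unitriangular_below[OF g] unitriangular_below[OF h] by simp
  next
    case 2
    moreover have "top_left m g = top_left m h" using proj by (simp add: block_proj_def)
    ultimately show ?thesis by (metis top_left_index)
  next
    case 3
    moreover have "bottom_right m g $$ (i - m, j - m) = bottom_right m h $$ (i - m, j - m)"
      using proj by (simp add: block_proj_def)
    ultimately show ?thesis using ij by (simp add: bottom_right_index)
  next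
    case 4
    then show ?thesis
      using ij arg_cong[OF corner, of "\<lambda>x. x $$ (i, j - (m + 1))"]
      by (simp add: corner_index)
  qed
qed

lemma block_proj_closed:
  assumes g: "g \<in> carrier (unitriangular (2 * m + 1))"
  shows "block_proj m g \<in> carrier (block_group m)"
proof -
  have "top_left m g \<in> carrier (unitriangular (m + 1))"
    using unitriangular_below[OF g] unitriangular_diag[OF g]
    by (intro unitriangularI) (auto simp: top_left_def)
  moreover have "bottom_right m g \<in> carrier (unitriangular (m + 1))"
    using unitriangular_below[OF g] unitriangular_diag[OF g]
    by (intro unitriangularI) (auto simp: bottom_right_def)
  ultimately show ?thesis by (simp add: block_proj_def)
qed

text \<open>For the upper block, rows of h beyond m vanish in columns up to m; for the lower block,
  columns of g before m vanish in rows from m on. In the corner all three index ranges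
  survive.\<close>

lemma
  assumes g: "g \<in> carrier (unitriangular (2 * m + 1))" and h: "h \<in> carrier (unitriangular (2 * m + 1))"
  shows block_proj_mult: "block_proj m (g * h) = block_proj m g \<otimes>\<^bsub>block_group m\<^esub> block_proj m h"
    and corner_mult: "corner m (g * h) = del_last m (fst (block_proj m g)) * corner m h
      + last_column m (fst (block_proj m g)) * first_row m (snd (block_proj m h))
      + corner m g * del_first (snd (block_proj m h))"
proof -
  note mats = unitriangular_mat[OF g] unitriangular_mat[OF h]
  \<comment> \<open>The single index m belongs to both diagonal blocks; in the corner its summand is
    an entry of a column times a row, the source of the cup product.\<close>
  have gh: "(g * h) $$ (i, j) = (\<Sum>k<m. g $$ (i, k) * h $$ (k, j)) + g $$ (i, m) * h $$ (m, j)
      + (\<Sum>k<m. g $$ (i, m + 1 + k) * h $$ (m + 1 + k, j))"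
    if "i < 2 * m + 1" "j < 2 * m + 1" for i j
    using sum_lessThan_add[of "\<lambda>k. g $$ (i, k) * h $$ (k, j)" "m + 1" m]
    by (simp add: mult_mat_index[OF mats that] mult_2 del: index_mult_mat(1))
  note tl = top_left_mat and br = bottom_right_mat
  have "top_left m (g * h) = top_left m g * top_left m h"
  proof (rule eq_matI)
    fix i j assume "i < dim_row (top_left m g * top_left m h)"
      "j < dim_col (top_left m g * top_left m h)"
    then have "i \<le> m" "j \<le> m" by (auto simp: top_left_def)
    then show "top_left m (g * h) $$ (i, j) = (top_left m g * top_left m h) $$ (i, j)"
      by (simp add: top_left_index gh mult_mat_index[OF tl tl] unitriangular_below[OF h]
          del: index_mult_mat(1))
  qed (simp_all add: top_left_def)
  moreover have "bottom_right m (g * h) = bottom_right m g * bottom_right m h"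
  proof (rule eq_matI)
    fix i j assume "i < dim_row (bottom_right m g * bottom_right m h)"
      "j < dim_col (bottom_right m g * bottom_right m h)"
    then have "i \<le> m" "j \<le> m" by (auto simp: bottom_right_def)
    then show "bottom_right m (g * h) $$ (i, j) = (bottom_right m g * bottom_right m h) $$ (i, j)"
      by (simp add: bottom_right_index gh mult_mat_index[OF br br] unitriangular_below[OF g]
          sum.lessThan_Suc_shift add_ac del: index_mult_mat(1) sum.lessThan_Suc)
  qed (simp_all add: bottom_right_def)
  ultimately show "block_proj m (g * h) = block_proj m g \<otimes>\<^bsub>block_group m\<^esub> block_proj m h"
    by (simp add: block_proj_def)
  let ?A = "del_last m (top_left m g)" and ?B = "del_first (bottom_right m h)"
  let ?a = "last_column m (top_left m g)" and ?b = "first_row m (bottom_right m h)"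
  have A: "?A \<in> carrier_mat m m" and B: "?B \<in> carrier_mat m m"
    by (rule del_last_mat[OF tl], rule del_first_mat[OF br])
  have "corner m (g * h) = ?A * corner m h + ?a * ?b + corner m g * ?B"
  proof (rule eq_matI)
    fix i j assume "i < dim_row (?A * corner m h + ?a * ?b + corner m g * ?B)"
      "j < dim_col (?A * corner m h + ?a * ?b + corner m g * ?B)"
    then have ij: "i < m" "j < m" using A B by (auto simp: corner_def)
    have "(?A * corner m h) $$ (i, j) = (\<Sum>k<m. g $$ (i, k) * h $$ (k, m + 1 + j))"
      using ij by (simp add: mult_mat_index[OF A corner_mat] del_last_index[OF tl] top_left_index
          corner_index del: index_mult_mat(1))
    moreover have "(?a * ?b) $$ (i, j) = g $$ (i, m) * h $$ (m, m + 1 + j)"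
      using ij by (simp add: mult_mat_index[OF last_column_mat first_row_mat] last_column_index
          first_row_index top_left_index bottom_right_index add_ac del: index_mult_mat(1))
    moreover have "(corner m g * ?B) $$ (i, j)
      = (\<Sum>k<m. g $$ (i, m + 1 + k) * h $$ (m + 1 + k, m + 1 + j))"
      using ij by (simp add: mult_mat_index[OF corner_mat B] del_first_index[OF br] bottom_right_index
          corner_index add_ac del: index_mult_mat(1))
    moreover have "corner m (g * h) $$ (i, j) = (g * h) $$ (i, m + 1 + j)"
      using ij by (simp add: corner_index del: index_mult_mat(1))
    ultimately show "corner m (g * h) $$ (i, j)
      = (?A * corner m h + ?a * ?b + corner m g * ?B) $$ (i, j)"
      using ij gh[of i "m + 1 + j"] carrier_matD[OF A] carrier_matD[OF B]
      by (simp del: index_mult_mat(1))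
  qed (use A B in \<open>auto simp: corner_def\<close>)
  then show "corner m (g * h) = del_last m (fst (block_proj m g)) * corner m h
      + last_column m (fst (block_proj m g)) * first_row m (snd (block_proj m h))
      + corner m g * del_first (snd (block_proj m h))"
    by (simp add: block_proj_def)
qed

section \<open>The embedded kernel and the matrix factors of the actions\<close>

lemma one_block_group: "\<one>\<^bsub>block_group m\<^esub> = (1\<^sub>m (m + 1), 1\<^sub>m (m + 1))"
  by (simp add: DirProd_def)

lemma S_embed_eq: "S_embed m X = assemble m (1\<^sub>m (m + 1), 1\<^sub>m (m + 1)) X"
  unfolding S_embed_def assemble_def by (rule eq_matI) auto

lemma
  shows S_embed_closed: "S_embed m X \<in> carrier (unitriangular (2 * m + 1))"
    and block_proj_S_embed: "block_proj m (S_embed m X) = (1\<^sub>m (m + 1), 1\<^sub>m (m + 1))"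
proof -
  have "(1\<^sub>m (m + 1), 1\<^sub>m (m + 1)) \<in> carrier (block_group m)"
    using group.is_monoid[OF group_block_group] monoid.one_closed one_block_group by metis
  then show "S_embed m X \<in> carrier (unitriangular (2 * m + 1))"
    "block_proj m (S_embed m X) = (1\<^sub>m (m + 1), 1\<^sub>m (m + 1))"
    unfolding S_embed_eq by (rule assemble_closed, rule block_proj_assemble)
qed

lemma corner_S_embed: "X \<in> carrier_mat m m \<Longrightarrow> corner m (S_embed m X) = X"
  by (simp add: S_embed_eq corner_assemble)

context
  fixes m :: nat and g :: "'a :: comm_ring_1 mat \<times> 'a mat"
  assumes g: "g \<in> carrier (block_group m)"
begin

lemma block_group_components:
  "fst g \<in> carrier (unitriangular (m + 1))" "snd g \<in> carrier (unitriangular (m + 1))"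
  using g by auto

lemma left_factor_mat: "del_last m (fst g) \<in> carrier_mat m m"
  by (intro unitriangular_mat del_last_closed block_group_components)

lemma right_block_mat: "del_first (snd g) \<in> carrier_mat m m"
  by (intro unitriangular_mat del_first_closed block_group_components)

lemma
  shows right_factor_mat: "inv\<^bsub>unitriangular m\<^esub> del_first (snd g) \<in> carrier_mat m m"
    and right_factor_left_inv: "inv\<^bsub>unitriangular m\<^esub> del_first (snd g) * del_first (snd g) = 1\<^sub>m m"
    and right_factor_right_inv: "del_first (snd g) * inv\<^bsub>unitriangular m\<^esub> del_first (snd g) = 1\<^sub>m m"
proof -
  interpret U: group "unitriangular m :: 'a mat monoid" by (rule group_unitriangular)
  have "del_first (snd g) \<in> carrier (unitriangular m)"
    by (intro del_first_closed block_group_components)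
  then show "inv\<^bsub>unitriangular m\<^esub> del_first (snd g) \<in> carrier_mat m m"
    "inv\<^bsub>unitriangular m\<^esub> del_first (snd g) * del_first (snd g) = 1\<^sub>m m"
    "del_first (snd g) * inv\<^bsub>unitriangular m\<^esub> del_first (snd g) = 1\<^sub>m m"
    using U.l_inv U.r_inv by (auto intro: unitriangular_mat)
qed

end

text \<open>Inversion reverses products, which is why multiplying by these inverses on the right
  gives a left action.\<close>

lemma
  assumes g: "g \<in> carrier (block_group m)" and h: "h \<in> carrier (block_group m)"
  shows left_factor_mult: "del_last m (fst (g \<otimes>\<^bsub>block_group m\<^esub> h))
      = del_last m (fst g) * del_last m (fst h)"
    and right_factor_mult: "inv\<^bsub>unitriangular m\<^esub> del_first (snd (g \<otimes>\<^bsub>block_group m\<^esub> h))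
      = inv\<^bsub>unitriangular m\<^esub> del_first (snd h) * inv\<^bsub>unitriangular m\<^esub> del_first (snd g)"
    and last_column_fst_mult: "last_column m (fst (g \<otimes>\<^bsub>block_group m\<^esub> h))
      = last_column m (fst g) + del_last m (fst g) * last_column m (fst h)"
    and first_row_snd_mult: "first_row m (snd (g \<otimes>\<^bsub>block_group m\<^esub> h))
      = first_row m (snd h) + first_row m (snd g) * del_first (snd h)"
proof -
  interpret U: group "unitriangular m :: 'a mat monoid" by (rule group_unitriangular)
  note comps = block_group_components[OF g] block_group_components[OF h]
  show "del_last m (fst (g \<otimes>\<^bsub>block_group m\<^esub> h)) = del_last m (fst g) * del_last m (fst h)"
    "last_column m (fst (g \<otimes>\<^bsub>block_group m\<^esub> h))
      = last_column m (fst g) + del_last m (fst g) * last_column m (fst h)"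
    "first_row m (snd (g \<otimes>\<^bsub>block_group m\<^esub> h))
      = first_row m (snd h) + first_row m (snd g) * del_first (snd h)"
    unfolding mult_DirProd' using comps
    by (simp_all add: del_last_mult last_column_mult first_row_mult)
  have *: "del_first (snd (g \<otimes>\<^bsub>block_group m\<^esub> h)) = del_first (snd g) * del_first (snd h)"
    unfolding mult_DirProd' using del_first_mult[OF comps(2,4)] by simp
  show "inv\<^bsub>unitriangular m\<^esub> del_first (snd (g \<otimes>\<^bsub>block_group m\<^esub> h))
      = inv\<^bsub>unitriangular m\<^esub> del_first (snd h) * inv\<^bsub>unitriangular m\<^esub> del_first (snd g)"
    unfolding * using U.inv_mult_group[OF del_first_closed[OF comps(2)] del_first_closed[OF comps(4)]]
    by simp
qed

lemma right_factor_one: "inv\<^bsub>unitriangular m\<^esub> (1\<^sub>m m :: 'a :: comm_ring_1 mat) = 1\<^sub>m m"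
  using monoid.inv_one[OF group.is_monoid[OF group_unitriangular, of m]] by simp

section \<open>The modules, the pairing and the 1-cocycles\<close>

lemma group_module_S: "group_module (block_group m)
    (monoid_mat TYPE('a :: comm_ring_1) m m) (S_act m)"
proof (intro group_module.intro group_module_axioms.intro group_block_group comm_group_mat)
  fix g h :: "'a mat \<times> 'a mat" and X
  assume g: "g \<in> carrier (block_group m)" and h: "h \<in> carrier (block_group m)"
    and "X \<in> carrier (monoid_mat TYPE('a) m m)"
  then have X: "X \<in> carrier_mat m m" by simp
  note mats = left_factor_mat[OF g] left_factor_mat[OF h] right_factor_mat[OF g] right_factor_mat[OF h]
  show "S_act m (g \<otimes>\<^bsub>block_group m\<^esub> h) X = S_act m g (S_act m h X)"
    using mats X unfolding S_act_def case_prod_beta left_factor_mult[OF g h] right_factor_mult[OF g h]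
    by (simp add: assoc_mult_mat[of _ m m _ m _ m] mult_carrier_mat[of _ m m _ m])
qed (auto simp: S_act_def case_prod_beta one_block_group right_factor_one mult_add_distrib_mat[of _ m m _ m]
    add_mult_distrib_mat[of _ m m _ _ m] left_factor_mat right_factor_mat mult_carrier_mat[of _ m m _ m]
    simp del: One_nat_def Suc_eq_plus1 add_Suc_right)

lemma group_module_V: "group_module (block_group m)
    (monoid_mat TYPE('a :: comm_ring_1) m 1) (V_act m)"
proof (intro group_module.intro group_module_axioms.intro group_block_group comm_group_mat)
  fix g h :: "'a mat \<times> 'a mat" and v
  assume g: "g \<in> carrier (block_group m)" and h: "h \<in> carrier (block_group m)"
    and "v \<in> carrier (monoid_mat TYPE('a) m 1)"
  then have v: "v \<in> carrier_mat m 1" by simp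
  show "V_act m (g \<otimes>\<^bsub>block_group m\<^esub> h) v = V_act m g (V_act m h v)"
    using left_factor_mat[OF g] left_factor_mat[OF h] v
    unfolding V_act_def case_prod_beta left_factor_mult[OF g h]
    by (simp add: assoc_mult_mat[of _ m m _ m _ 1])
qed (auto simp: V_act_def case_prod_beta one_block_group mult_add_distrib_mat[of _ m m _ 1]
    left_factor_mat mult_carrier_mat[of _ m m _ 1] simp del: One_nat_def)

lemma group_module_V_dual: "group_module (block_group m)
    (monoid_mat TYPE('a :: comm_ring_1) 1 m) (V_dual_act m)"
proof (intro group_module.intro group_module_axioms.intro group_block_group comm_group_mat)
  fix g h :: "'a mat \<times> 'a mat" and r
  assume g: "g \<in> carrier (block_group m)" and h: "h \<in> carrier (block_group m)"
    and "r \<in> carrier (monoid_mat TYPE('a) 1 m)"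
  then have r: "r \<in> carrier_mat 1 m" by simp
  show "V_dual_act m (g \<otimes>\<^bsub>block_group m\<^esub> h) r = V_dual_act m g (V_dual_act m h r)"
    using right_factor_mat[OF g] right_factor_mat[OF h] r
    unfolding V_dual_act_def case_prod_beta right_factor_mult[OF g h]
    by (simp add: assoc_mult_mat[of _ 1 m _ m _ m])
qed (auto simp: V_dual_act_def case_prod_beta one_block_group right_factor_one
    add_mult_distrib_mat[of _ 1 m _ _ m] right_factor_mat simp del: One_nat_def)

text \<open>Equivariance is associativity: both sides are \<pi>(g1) v r times the inverse of
  \<pi>'(g2).\<close>

lemma equivariant_pairing_outer: "equivariant_pairing (block_group m)
    (monoid_mat TYPE('a :: comm_ring_1) m 1) (V_act m) (monoid_mat TYPE('a) 1 m) (V_dual_act m)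
    (monoid_mat TYPE('a) m m) (S_act m) (\<lambda>v r. v * r)"
proof (intro equivariant_pairing.intro equivariant_pairing_axioms.intro
    group_module_S group_module_V group_module_V_dual)
  fix g :: "'a mat \<times> 'a mat" and v r :: "'a mat"
  assume g: "g \<in> carrier (block_group m)" and "v \<in> carrier (monoid_mat TYPE('a) m 1)"
    and "r \<in> carrier (monoid_mat TYPE('a) 1 m)"
  then have v: "v \<in> carrier_mat m 1" and r: "r \<in> carrier_mat 1 m" by simp_all
  note mats = left_factor_mat[OF g] right_factor_mat[OF g]
  show "V_act m g v * V_dual_act m g r = S_act m g (v * r)"
    using mats v r mult_carrier_mat[OF r mats(2)]
    unfolding V_act_def V_dual_act_def S_act_def case_prod_beta
    by (simp add: assoc_mult_mat[OF mats(1) v mult_carrier_mat[OF r mats(2)]]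
        assoc_mult_mat[OF mats(1) mult_carrier_mat[OF v r] mats(2)]
        assoc_mult_mat[OF v r mats(2)] del: One_nat_def)
qed (auto simp: add_mult_distrib_mat[of _ m 1 _ _ m] mult_add_distrib_mat[of _ m 1 _ m]
    simp del: One_nat_def)

lemma phi1_cocycle:
  "phi1 m \<in> one_cocycles (block_group m) (monoid_mat TYPE('a :: comm_ring_1) m 1) (V_act m)"
  unfolding one_cocycles_def phi1_def V_act_def
  by (simp add: case_prod_beta last_column_fst_mult del: One_nat_def mult_DirProd)

lemma phi2_mat: "g \<in> carrier (block_group m) \<Longrightarrow> phi2 m g \<in> carrier_mat 1 m"
  unfolding phi2_def case_prod_beta 
  by (rule mult_carrier_mat[OF first_row_mat right_factor_mat])

lemma phi2_cocycle:
  "phi2 m \<in> one_cocycles (block_group m) (monoid_mat TYPE('a :: comm_ring_1) 1 m) (V_dual_act m)"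
proof -
  have "phi2 m (g \<otimes>\<^bsub>block_group m\<^esub> h) = phi2 m g + V_dual_act m g (phi2 m h)"
    if g: "g \<in> carrier (block_group m)" and h: "h \<in> carrier (block_group m)"
    for g h :: "'a mat \<times> 'a mat"
  proof -
    let ?Bg = "del_first (snd g)" and ?Bh = "del_first (snd h)"
    let ?Cg = "inv\<^bsub>unitriangular m\<^esub> del_first (snd g)"
    let ?Ch = "inv\<^bsub>unitriangular m\<^esub> del_first (snd h)"
    let ?rg = "first_row m (snd g)" and ?rh = "first_row m (snd h)"
    note mats = right_factor_mat[OF g] right_factor_mat[OF h] right_block_mat[OF g] right_block_mat[OF h]
    have r: "?rg \<in> carrier_mat 1 m" "?rh \<in> carrier_mat 1 m" by (rule first_row_mat)+
    \<comment> \<open>The right action of h in the row formula meets its own inverse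
      \<open>?Ch\<close> and disappears, leaving only the inverse factor of g.\<close>
    have "(?rh + ?rg * ?Bh) * (?Ch * ?Cg) = ?rh * (?Ch * ?Cg) + ?rg * (?Bh * ?Ch) * ?Cg"
      using mats r by (simp add: add_mult_distrib_mat[of _ 1 m _ _ m] assoc_mult_mat[of _ 1 m _ m _ m]
          assoc_mult_mat[of _ m m _ m _ m] mult_carrier_mat[of _ m m _ m] mult_carrier_mat[of _ 1 m _ m]
          del: One_nat_def)
    also have "\<dots> = ?rh * ?Ch * ?Cg + ?rg * ?Cg"
      using mats r by (simp add: right_factor_right_inv[OF h] assoc_mult_mat[of _ 1 m _ m _ m]
          right_mult_one_mat[of _ 1] del: One_nat_def)
    also have "\<dots> = ?rg * ?Cg + ?rh * ?Ch * ?Cg"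
      using mats r by (intro comm_add_mat[of _ 1 m]) auto
    finally show ?thesis
      unfolding phi2_def V_dual_act_def case_prod_beta first_row_snd_mult[OF g h]
        right_factor_mult[OF g h] .
  qed
  then show ?thesis
    unfolding one_cocycles_def by (simp add: phi2_mat del: One_nat_def mult_DirProd)
qed

section \<open>The extension and the cocycle of its zero-corner section\<close>

lemma abelian_extension_block: "abelian_extension (block_group m)
    (monoid_mat TYPE('a :: comm_ring_1) m m) (S_act m) (unitriangular (2 * m + 1))
    (S_embed m) (block_proj m)"
proof -
  interpret M: group_module "block_group m" "monoid_mat TYPE('a) m m" "S_act m"
    by (rule group_module_S)
  interpret U: group "unitriangular (2 * m + 1) :: 'a mat monoid" by (rule group_unitriangular)
  \<comment> \<open>Kernel factors do not affect \<open>block_proj\<close>, so products with them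
    are compared in the corner alone. The homomorphism and conjugation axioms are reduced to
    this.\<close>
  have embed_mult: "S_embed m X * e \<in> carrier (unitriangular (2 * m + 1))"
    "block_proj m (S_embed m X * e) = block_proj m e"
    "corner m (S_embed m X * e) = corner m e + X * del_first (snd (block_proj m e))"
    if X: "X \<in> carrier_mat m m" and e: "e \<in> carrier (unitriangular (2 * m + 1))"
    for X e :: "'a mat"
  proof -
    show "S_embed m X * e \<in> carrier (unitriangular (2 * m + 1))"
      using e S_embed_closed by (intro unitriangular_mult_closed)
    show "block_proj m (S_embed m X * e) = block_proj m e"
      using M.G.l_one[OF block_proj_closed[OF e]]
      unfolding block_proj_mult[OF S_embed_closed e] block_proj_S_embed one_block_group .
    show "corner m (S_embed m X * e) = corner m e + X * del_first (snd (block_proj m e))"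
      using X right_block_mat[OF block_proj_closed[OF e]] corner_mat[of m e]
      unfolding corner_mult[OF S_embed_closed e] block_proj_S_embed
      by (simp add: corner_S_embed left_mult_zero_mat[of _ 1 m] left_mult_one_mat[OF corner_mat]
          right_add_zero_mat[OF corner_mat] del: One_nat_def Suc_eq_plus1 add_Suc_right)
  qed
  have mult_embed: "e * S_embed m X \<in> carrier (unitriangular (2 * m + 1))"
    "block_proj m (e * S_embed m X) = block_proj m e"
    "corner m (e * S_embed m X) = del_last m (fst (block_proj m e)) * X + corner m e"
    if X: "X \<in> carrier_mat m m" and e: "e \<in> carrier (unitriangular (2 * m + 1))"
    for X e :: "'a mat"
  proof -
    show "e * S_embed m X \<in> carrier (unitriangular (2 * m + 1))"
      using e S_embed_closed by (intro unitriangular_mult_closed)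
    show "block_proj m (e * S_embed m X) = block_proj m e"
      using M.G.r_one[OF block_proj_closed[OF e]]
      unfolding block_proj_mult[OF e S_embed_closed] block_proj_S_embed one_block_group .
    show "corner m (e * S_embed m X) = del_last m (fst (block_proj m e)) * X + corner m e"
      using X left_factor_mat[OF block_proj_closed[OF e]] corner_mat[of m e]
      unfolding corner_mult[OF e S_embed_closed] block_proj_S_embed
      by (simp add: corner_S_embed right_mult_zero_mat[of _ m 1] mult_carrier_mat[of _ m m _ m]
          right_mult_one_mat[of _ m] del: One_nat_def Suc_eq_plus1 add_Suc_right)
  qed
  show ?thesis
  proof (intro abelian_extension.intro abelian_extension_axioms.intro
      M.group_module_axioms U.group_axioms)
    show "S_embed m \<in> hom (monoid_mat TYPE('a) m m) (unitriangular (2 * m + 1))"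
    proof (rule homI)
      fix X Y assume "X \<in> carrier (monoid_mat TYPE('a) m m)" "Y \<in> carrier (monoid_mat TYPE('a) m m)"
      then have X: "X \<in> carrier_mat m m" and Y: "Y \<in> carrier_mat m m" by simp_all
      have "S_embed m (X + Y) = S_embed m X * S_embed m Y"
      proof (rule unitriangular_block_eqI)
        note XY = embed_mult[OF X S_embed_closed, of Y]
        show "S_embed m X * S_embed m Y \<in> carrier (unitriangular (2 * m + 1))" by (rule XY)
        show "block_proj m (S_embed m (X + Y)) = block_proj m (S_embed m X * S_embed m Y)"
          unfolding XY(2) block_proj_S_embed ..
        show "corner m (S_embed m (X + Y)) = corner m (S_embed m X * S_embed m Y)"
          unfolding XY(3) block_proj_S_embed snd_conv del_first_one right_mult_one_mat[OF X]
            comm_add_mat[OF X Y] by (simp add: corner_S_embed X Y)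
      qed (rule S_embed_closed)
      then show "S_embed m (X \<otimes>\<^bsub>monoid_mat TYPE('a) m m\<^esub> Y)
        = S_embed m X \<otimes>\<^bsub>unitriangular (2 * m + 1)\<^esub> S_embed m Y" by simp
    qed (rule S_embed_closed)
    show "inj_on (S_embed m) (carrier (monoid_mat TYPE('a) m m))"
      by (rule inj_on_inverseI[of _ "corner m"]) (simp add: corner_S_embed)
    show "block_proj m \<in> hom (unitriangular (2 * m + 1)) (block_group m)"
      by (intro homI block_proj_closed) (simp_all only: block_proj_mult unitriangular_simps)
    show "block_proj m ` carrier (unitriangular (2 * m + 1) :: 'a mat monoid) = carrier (block_group m)"
    proof
      show "carrier (block_group m)
        \<subseteq> block_proj m ` carrier (unitriangular (2 * m + 1) :: 'a mat monoid)"
      proof (rule subsetI)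
        fix g :: "'a mat \<times> 'a mat" assume "g \<in> carrier (block_group m)"
        then show "g \<in> block_proj m ` carrier (unitriangular (2 * m + 1))"
          \<comment> \<open>Any corner serves for the preimage; both facts hold for arbitrary
            \<open>X\<close>.\<close>
          using assemble_closed block_proj_assemble by (metis imageI)
      qed
    qed (rule image_subsetI, rule block_proj_closed)
    show "S_embed m ` carrier (monoid_mat TYPE('a) m m)
      = kernel (unitriangular (2 * m + 1)) (block_group m) (block_proj m)"
    proof
      show "S_embed m ` carrier (monoid_mat TYPE('a) m m)
        \<subseteq> kernel (unitriangular (2 * m + 1)) (block_group m) (block_proj m)"
        unfolding kernel_def one_block_group using S_embed_closed block_proj_S_embed by auto
      show "kernel (unitriangular (2 * m + 1)) (block_group m) (block_proj m)
        \<subseteq> S_embed m ` carrier (monoid_mat TYPE('a) m m)"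
      proof
        fix e :: "'a mat"
        assume "e \<in> kernel (unitriangular (2 * m + 1)) (block_group m) (block_proj m)"
        then have "e \<in> carrier (unitriangular (2 * m + 1))"
          and "block_proj m e = (1\<^sub>m (m + 1), 1\<^sub>m (m + 1))"
          unfolding kernel_def one_block_group by auto
        then have "e = S_embed m (corner m e)"
          by - (rule unitriangular_block_eqI[of _ m],
            simp_all only: S_embed_closed block_proj_S_embed corner_S_embed corner_mat)
        then show "e \<in> S_embed m ` carrier (monoid_mat TYPE('a) m m)" by (rule image_eqI) simp
      qed
    qed
    fix e X :: "'a mat"
    assume e: "e \<in> carrier (unitriangular (2 * m + 1))" and "X \<in> carrier (monoid_mat TYPE('a) m m)"
    then have X: "X \<in> carrier_mat m m" by simp
    let ?g = "block_proj m e"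
    have g: "?g \<in> carrier (block_group m)" by (rule block_proj_closed[OF e])
    have gX: "S_act m ?g X \<in> carrier_mat m m"
      using M.act_closed[OF g] X by simp
    note mats = left_factor_mat[OF g] right_factor_mat[OF g] right_block_mat[OF g]
    \<comment> \<open>The inverse inside \<open>S_act\<close> cancels against the lower diagonal
      block of e, so the corners of the two products agree and the inverse of e need not be
      known.\<close>
    have "S_act m ?g X * del_first (snd ?g) = del_last m (fst ?g) * X"
      unfolding S_act_def case_prod_beta
      using right_mult_one_mat[OF mult_carrier_mat[OF mats(1) X]]
      by (simp add: assoc_mult_mat[OF mult_carrier_mat[OF mats(1) X] mats(2,3)]
          right_factor_left_inv[OF g])
    then have "e * S_embed m X = S_embed m (S_act m ?g X) * e"
      using mult_embed[OF X e] embed_mult[OF gX e] mult_carrier_mat[OF mats(1) X] corner_mat[of m e]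
      by - (rule unitriangular_block_eqI[of _ m], simp_all only: comm_add_mat)
    then show "e \<otimes>\<^bsub>unitriangular (2 * m + 1)\<^esub> S_embed m X
        \<otimes>\<^bsub>unitriangular (2 * m + 1)\<^esub> inv\<^bsub>unitriangular (2 * m + 1)\<^esub> e
      = S_embed m (S_act m ?g X)"
      using U.inv_solve_right'[OF S_embed_closed mult_embed(1)[OF X e] e] by simp
  qed
qed

text \<open>The claimed value is verified through \<open>section_cocycleI\<close>: the two products
  have the same blocks, and their corners agree once the inverse factors are collected.\<close>

lemma section_cocycle_assemble:
  fixes m :: nat
  defines "s \<equiv> \<lambda>g :: 'a :: comm_ring_1 mat \<times> 'a mat. assemble m g (0\<^sub>m m m)"
  shows "s \<in> set_sections (block_group m) (unitriangular (2 * m + 1)) (block_proj m)"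
    and "section_cocycle (block_group m) (monoid_mat TYPE('a) m m) (unitriangular (2 * m + 1))
        (S_embed m) s
      = cup_cocycle (block_group m) (V_dual_act m) (\<lambda>v r. v * r) (phi1 m) (phi2 m)"
proof -
  interpret X: abelian_extension "block_group m" "monoid_mat TYPE('a) m m" "S_act m"
    "unitriangular (2 * m + 1)" "S_embed m" "block_proj m"
    by (rule abelian_extension_block)
  show sections: "s \<in> set_sections (block_group m) (unitriangular (2 * m + 1)) (block_proj m)"
    unfolding set_sections_def s_def
    by (intro CollectI conjI Pi_I ballI assemble_closed block_proj_assemble)
  have "section_cocycle (block_group m) (monoid_mat TYPE('a) m m) (unitriangular (2 * m + 1))
      (S_embed m) s (g, h) = phi1 m g * V_dual_act m g (phi2 m h)"
    if g: "g \<in> carrier (block_group m)" and h: "h \<in> carrier (block_group m)" for g h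
  proof (rule X.section_cocycleI[OF sections g h])
    let ?gh = "g \<otimes>\<^bsub>block_group m\<^esub> h" and ?F = "phi1 m g * V_dual_act m g (phi2 m h)"
    have gh: "?gh \<in> carrier (block_group m)" using g h by (rule X.G.m_closed)
    let ?C = "inv\<^bsub>unitriangular m\<^esub> del_first (snd ?gh)"
    let ?a = "last_column m (fst g)" and ?b = "first_row m (snd h)"
    note ab = mult_carrier_mat[OF last_column_mat[of m "fst g"] first_row_mat[of m "snd h"]]
    \<comment> \<open>The inverse factor of h from \<open>phi2\<close> and that of g from the action
      combine, in this order, into the inverse factor of gh.\<close>
    have F_eq: "?F = ?a * ?b * ?C"
      unfolding phi1_def phi2_def V_dual_act_def case_prod_beta right_factor_mult[OF g h]
      by (simp only: assoc_mult_mat[OF first_row_mat right_factor_mat[OF h] right_factor_mat[OF g]]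
          assoc_mult_mat[OF last_column_mat first_row_mat
            mult_carrier_mat[OF right_factor_mat[OF h] right_factor_mat[OF g]]])
    have F: "?F \<in> carrier_mat m m"
      unfolding F_eq by (rule mult_carrier_mat[OF ab right_factor_mat[OF gh]])
    then show "?F \<in> carrier (monoid_mat TYPE('a) m m)" by simp
    have F_right: "?F * del_first (snd ?gh) = ?a * ?b"
      unfolding F_eq assoc_mult_mat[OF ab right_factor_mat[OF gh] right_block_mat[OF gh]]
        right_factor_left_inv[OF gh] by (rule right_mult_one_mat[OF ab])
    have s_closed: "s x \<in> carrier (unitriangular (2 * m + 1))"
      and s_proj: "block_proj m (s x) = x" if "x \<in> carrier (block_group m)" for x
      unfolding s_def using that by (rule assemble_closed, rule block_proj_assemble)
    have s_corner: "corner m (s x) = 0\<^sub>m m m" for x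
      unfolding s_def by (rule corner_assemble) simp
    have "corner m (s g * s h) = ?a * ?b"
      unfolding corner_mult[OF s_closed[OF g] s_closed[OF h]] s_proj[OF g] s_proj[OF h] s_corner
        right_mult_zero_mat[OF left_factor_mat[OF g]] left_mult_zero_mat[OF right_block_mat[OF h]]
        left_add_zero_mat[OF ab] by (rule right_add_zero_mat[OF ab])
    \<comment> \<open>Only the last term of \<open>corner_mult\<close> survives: s(gh) has zero
      corner, and the upper block of \<open>S_embed\<close> is the identity, with zero last
      column.\<close>
    moreover have "corner m (S_embed m ?F * s ?gh) = ?a * ?b"
      unfolding corner_mult[OF S_embed_closed s_closed[OF gh]] s_proj[OF gh] s_corner
        block_proj_S_embed fst_conv snd_conv last_column_one del_last_one corner_S_embed[OF F] F_right
        left_mult_zero_mat[OF first_row_mat] right_mult_zero_mat[OF one_carrier_mat]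
        left_add_zero_mat[OF zero_carrier_mat] by (rule left_add_zero_mat[OF ab])
    moreover have "block_proj m (s g * s h) = ?gh"
      unfolding block_proj_mult[OF s_closed[OF g] s_closed[OF h]] s_proj[OF g] s_proj[OF h] ..
    moreover have "block_proj m (S_embed m ?F * s ?gh) = ?gh"
      using X.G.l_one[OF gh]
      unfolding block_proj_mult[OF S_embed_closed s_closed[OF gh]] s_proj[OF gh] block_proj_S_embed
        one_block_group .
    ultimately have "s g * s h = S_embed m ?F * s ?gh"
      by - (rule unitriangular_block_eqI[OF unitriangular_mult_closed[OF s_closed[OF g] s_closed[OF h]]
            unitriangular_mult_closed[OF S_embed_closed s_closed[OF gh]]],
          simp_all)
    then show "s g \<otimes>\<^bsub>unitriangular (2 * m + 1)\<^esub> s h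
      = S_embed m ?F \<otimes>\<^bsub>unitriangular (2 * m + 1)\<^esub> s ?gh" by simp
  qed
  then show "section_cocycle (block_group m) (monoid_mat TYPE('a) m m) (unitriangular (2 * m + 1))
        (S_embed m) s
      = cup_cocycle (block_group m) (V_dual_act m) (\<lambda>v r. v * r) (phi1 m) (phi2 m)"
    unfolding cup_cocycle_def
    by (intro extensionalityI[where A = "carrier (block_group m) \<times> carrier (block_group m)"])
      (auto simp: section_cocycle_def)
qed

text \<open>The conjuncts before the final equation certify its ingredients: the action is
  conjugation, the pairing is equivariant, \<open>phi1\<close> and \<open>phi2\<close> are cocycles,
  and the extension class is an element of \<open>H2\<close>.\<close>

theorem theorem5p1:
  fixes m n :: nat
    and G :: "('p :: prime_card mod_ring mat \<times> 'p mod_ring mat) monoid"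
    and U S V V' :: "'p mod_ring mat monoid"
  assumes "m \<ge> 1" and "n = 2 * m + 1"
    and "G = unitriangular (m + 1) \<times>\<times> unitriangular (m + 1)"
    and "U = unitriangular n"
    and "S = monoid_mat TYPE('p mod_ring) m m"
    and "V = monoid_mat TYPE('p mod_ring) m 1"
    and "V' = monoid_mat TYPE('p mod_ring) 1 m"
  shows "abelian_extension G S (S_act m) U (S_embed m) (block_proj m)
    \<and> equivariant_pairing G V (V_act m) V' (V_dual_act m) S (S_act m) (\<lambda>v r. v * r)
    \<and> phi1 m \<in> one_cocycles G V (V_act m)
    \<and> phi2 m \<in> one_cocycles G V' (V_dual_act m)
    \<and> extension_class G S (S_act m) U (S_embed m) (block_proj m) \<in> carrier (H2 G S (S_act m))
    \<and> extension_class G S (S_act m) U (S_embed m) (block_proj m)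
        = cup_product G (V_dual_act m) S (S_act m) (\<lambda>v r. v * r) (phi1 m) (phi2 m)"
proof -
  note G = assms(3) and U = assms(4)[unfolded assms(2)] and mods = assms(5-7)
  interpret X: abelian_extension G S "S_act m" U "S_embed m" "block_proj m"
    unfolding G U mods by (rule abelian_extension_block)
  obtain s where s: "s \<in> set_sections G U (block_proj m)"
    and cup: "section_cocycle G S U (S_embed m) s
      = cup_cocycle G (V_dual_act m) (\<lambda>v r. v * r) (phi1 m) (phi2 m)"
    using section_cocycle_assemble unfolding G U mods by blast
  have class_eq: "extension_class G S (S_act m) U (S_embed m) (block_proj m)
      = H2_class G S (S_act m) (section_cocycle G S U (S_embed m) s)"
    by (rule X.extension_class_eq[OF s])
  show ?thesis
  proof (intro conjI)
    show "abelian_extension G S (S_act m) U (S_embed m) (block_proj m)"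
      by (rule X.abelian_extension_axioms)
    show "equivariant_pairing G V (V_act m) V' (V_dual_act m) S (S_act m) (\<lambda>v r. v * r)"
      unfolding G mods by (rule equivariant_pairing_outer)
    show "phi1 m \<in> one_cocycles G V (V_act m)"
      unfolding G mods by (rule phi1_cocycle)
    show "phi2 m \<in> one_cocycles G V' (V_dual_act m)"
      unfolding G mods by (rule phi2_cocycle)
    show "extension_class G S (S_act m) U (S_embed m) (block_proj m) \<in> carrier (H2 G S (S_act m))"
      unfolding class_eq by (intro X.H2_class_closed X.section_cocycle_cocycle[OF s])
    show "extension_class G S (S_act m) U (S_embed m) (block_proj m)
        = cup_product G (V_dual_act m) S (S_act m) (\<lambda>v r. v * r) (phi1 m) (phi2 m)"
      unfolding cup_product_def cup[symmetric] by (rule class_eq)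
  qed
qed

end
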